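(* Consider, for every $m\in\mathbb{N}$, the model $y_m=A_mx_m^*+\varepsilon_m$ with $A_m\in\mathbb{R}^{m\times m}$ and $\varepsilon_m\sim\mathcal{N}(0,\sigma^2I_m)$, where $\sigma^2>0$ does not depend on $m$, and suppose that the singular values of $A_m$ satisfy $1=\gamma_{1,m}\ge\gamma_{2,m}\ge\dots\ge\gamma_{m,m}\ge 0$. Then for any sequence of vectors $(x_m^* )_{m\in\mathbb{N}}$, $x_m^*\in\mathbb{R}^m$, such that $\|x_m^*\|_2^2=O(m)$, we have, as $m\to\infty$, $$\sup_{\alpha\in[0,\infty)}\Bigl|\frac1m\,\mathrm{PSURE}_m(\alpha,y_m)-\mathcal{L}_m(\alpha)\Bigr|=O_{\mathbb{P}}\Bigl(\frac{1}{\sqrt m}\Bigr).$$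
   Context: Tikhonov estimator: for $\alpha>0$, $\hat x_\alpha(y)=(A_m^{T}A_m+\alpha I)^{-1}A_m^{T}y$; for $\alpha=0$ all quantities are understood as limits $\alpha\downarrow0$ (so $\hat x_0(y)=A_m^{+}y$ with $A_m^+$ the Moore–Penrose pseudoinverse). Prediction loss: $\mathcal{L}_m(\alpha)=\frac1m\|A_mx_m^*-A_m\hat x_\alpha(y_m)\|_2^2$ (a random function of $\alpha$). Risk estimator: $$\mathrm{PSURE}_m(\alpha,y)=\|y-A_m\hat x_\alpha(y)\|_2^2-m\sigma^2+2\sigma^2\,\mathrm{tr}\bigl(A_m(A_m^{T}A_m+\alpha I)^{-1}A_m^{T}\bigr).$$ Equivalently, with a singular value decomposition $A_m=U\Sigma V^{T}$, $\Sigma=\mathrm{diag}(\gamma_{1,m},\dots,\gamma_{m,m})$, $u_i$ the columns of $U$ and $y_i=\langle u_i,y\rangle$, $$\mathrm{PSURE}_m(\alpha,y)=\sum_{i=1}^m\frac{\alpha^2}{(\gamma_{i,m}^2+\alpha)^2}y_i^2-m\sigma^2+2\sigma^2\sum_{i=1}^m\frac{\gamma_{i,m}^2}{\gamma_{i,m}^2+\alpha}.$$ Stochastic order symbol: for random variables $Z_m$ and positive numbers $r_m$, $Z_m=O_{\mathbb{P}}(r_m)$ means $\lim_{T\to\infty}\limsup_{m\to\infty}\mathbb{P}(|Z_m|>Tr_m)=0$. *)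

theory Defs
  imports
    "HOL-Probability.Probability"
    "HOL-Library.Landau_Symbols"
    "Jordan_Normal_Form.Matrix"
    "Jordan_Normal_Form.Gauss_Jordan_Elimination"
begin

text \<open>
  The dimension m runs through the natural numbers inside the statements, so vectors and matrices
  are those of \<open>Jordan_Normal_Form\<close>, whose dimensions are terms. All indices start at 0.
\<close>

hide_type (open) Finite_Cartesian_Product.vec
hide_const (open) Finite_Cartesian_Product.vec
unbundle no vec_syntax
unbundle no inner_syntax

definition sq_norm2 :: "real vec \<Rightarrow> real" where
  "sq_norm2 v = v \<bullet> v"

definition trace_mat :: "real mat \<Rightarrow> real" where
  "trace_mat B = (\<Sum>i<dim_row B. B $$ (i, i))"

definition singular_values :: "real mat \<Rightarrow> (nat \<Rightarrow> real) \<Rightarrow> bool" where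
  "singular_values A \<gamma> \<longleftrightarrow>
     (let n = dim_row A in
        A \<in> carrier_mat n n \<and> (\<forall>i<n. 0 \<le> \<gamma> i) \<and>
        (\<exists>U V. U \<in> carrier_mat n n \<and> V \<in> carrier_mat n n \<and>
           transpose_mat U * U = 1\<^sub>m n \<and> transpose_mat V * V = 1\<^sub>m n \<and>
           A = U * mat_diag n \<gamma> * transpose_mat V))"

text \<open>
  The matrix of the linear map sending y to its Tikhonov estimate. For \<open>\<alpha> > 0\<close> the matrix to be
  inverted is positive definite, so \<open>mat_inverse\<close> yields \<open>Some\<close>. At \<open>\<alpha> = 0\<close> the value is the
  entrywise limit as \<open>\<alpha>\<close> decreases to 0. This limit always exists and is the Moore-Penrose
  pseudoinverse of A. The estimator, the loss and the risk estimate below depend continuously on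
  the entries of this matrix, so their values at 0 are their limits as well.
\<close>

definition tikhonov_mat :: "real mat \<Rightarrow> real \<Rightarrow> real mat" where
  "tikhonov_mat A \<alpha> =
     (let R = (\<lambda>\<beta>. the (mat_inverse (transpose_mat A * A + \<beta> \<cdot>\<^sub>m 1\<^sub>m (dim_col A))) * transpose_mat A)
      in if \<alpha> = 0
         then mat (dim_col A) (dim_row A) (\<lambda>ij. Lim (at_right 0) (\<lambda>\<beta>. R \<beta> $$ ij))
         else R \<alpha>)"

definition tikhonov :: "real mat \<Rightarrow> real \<Rightarrow> real vec \<Rightarrow> real vec" where
  "tikhonov A \<alpha> y = tikhonov_mat A \<alpha> *\<^sub>v y"

definition pred_loss :: "real mat \<Rightarrow> real vec \<Rightarrow> real \<Rightarrow> real vec \<Rightarrow> real" where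
  "pred_loss A xs \<alpha> y = sq_norm2 (A *\<^sub>v xs - A *\<^sub>v tikhonov A \<alpha> y) / real (dim_row A)"

definition PSURE :: "real mat \<Rightarrow> real \<Rightarrow> real \<Rightarrow> real vec \<Rightarrow> real" where
  "PSURE A \<sigma> \<alpha> y =
     sq_norm2 (y - A *\<^sub>v tikhonov A \<alpha> y) - real (dim_row A) * \<sigma>\<^sup>2
       + 2 * \<sigma>\<^sup>2 * trace_mat (A * tikhonov_mat A \<alpha>)"

text \<open>
  The law \<open>N(0, \<sigma>\<^sup>2 I)\<close> on n-dimensional space, as the n-fold product of \<open>N(0, \<sigma>\<^sup>2)\<close>, carried by
  the coordinate functions of the random vector. Note that \<open>normal_density\<close> takes the standard
  deviation as its second argument.
\<close>

definition gaussian_noise :: "'a measure \<Rightarrow> nat \<Rightarrow> real \<Rightarrow> ('a \<Rightarrow> real vec) \<Rightarrow> bool" where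
  "gaussian_noise M n \<sigma> \<epsilon> \<longleftrightarrow>
     (\<forall>\<omega>\<in>space M. \<epsilon> \<omega> \<in> carrier_vec n) \<and>
     (\<forall>i<n. (\<lambda>\<omega>. \<epsilon> \<omega> $ i) \<in> borel_measurable M) \<and>
     distr M (\<Pi>\<^sub>M i\<in>{..<n}. borel) (\<lambda>\<omega>. \<lambda>i\<in>{..<n}. \<epsilon> \<omega> $ i) =
       (\<Pi>\<^sub>M i\<in>{..<n}. density lborel (\<lambda>t. ennreal (normal_density 0 \<sigma> t)))"

text \<open>
  Stochastic boundedness \<open>Z m = O\<^sub>P(r m)\<close>. The variables may live on different probability spaces.
  They are extended real valued, so that a supremum over an infinite set is meaningful without a
  boundedness side condition. Measurability is part of the notion because \<open>measure\<close> is 0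
  on sets that are not measurable.
\<close>

definition bigo_prob ::
  "(nat \<Rightarrow> 'a measure) \<Rightarrow> (nat \<Rightarrow> 'a \<Rightarrow> ereal) \<Rightarrow> (nat \<Rightarrow> real) \<Rightarrow> bool" where
  "bigo_prob M Z r \<longleftrightarrow>
     (\<forall>m\<ge>1. Z m \<in> borel_measurable (M m)) \<and>
     ((\<lambda>T::real. limsup (\<lambda>m. ereal (measure (M m)
         {\<omega> \<in> space (M m). \<bar>Z m \<omega>\<bar> > ereal (T * r m)}))) \<longlongrightarrow> 0) at_top"

end

theory Submission
  imports Defs "Jordan_Normal_Form.Determinant"
begin

text \<open>In the basis of left singular vectors let \<open>e\<close> be the noise, \<open>b\<close> the exact data and
  \<open>f\<^sub>i = \<gamma>\<^sub>i\<^sup>2 / (\<gamma>\<^sub>i\<^sup>2 + \<alpha>)\<close> the filter. Then the unscaled difference of the risk estimate and the loss is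
  \<open>\<Sum>\<^sub>i 2 (1 - f\<^sub>i) b\<^sub>i e\<^sub>i + (1 - 2 f\<^sub>i) (e\<^sub>i\<^sup>2 - \<sigma>\<^sup>2)\<close>. For every \<open>\<alpha>\<close> the filter is nonincreasing in \<open>i\<close> with
  values in \<open>[0, 1]\<close>, so by summation by parts the supremum over \<open>\<alpha>\<close> is controlled by maximal
  partial sums of centred variables. The \<open>e\<^sub>i\<close> are independent because the Gaussian law is rotation
  invariant, and Kolmogorov's maximal inequality gives the rate.\<close>

subsection \<open>Rotation invariance of the Gaussian law\<close>

text \<open>For one fixed \<alpha> Chebyshev's inequality would be enough; the obstacle is that the
  worst \<alpha> depends on the noise. As only monotonicity of the filter is used, the family over
  \<alpha> is enlarged to all nonincreasing weights with values in [0, 1], possibly different at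
  each sample point. Their effect is governed by \<open>n + 1\<close> partial sums, so the tail
  bound needs no discretisation of \<alpha>. The price is that the summands have to be independent
  and not merely uncorrelated: the maximal inequality relies on each summand being independent of
  whether the sum has already been stopped. This is why the full rotation invariance of the Gaussian
  law is established and not only the covariance of the rotated noise. The rate comes from
  variances: those of the partial sums are at most of order \<open>sq_norm2 x + n\<close>, because
  singular values of at most 1 do not enlarge the coordinates of \<open>x\<close>. Under the growth
  condition this is of order \<open>n\<close>, hence the unscaled supremum is of order
  \<open>sqrt n\<close>.\<close>

abbreviation normal_law :: "real \<Rightarrow> real measure" where
  "normal_law \<sigma> \<equiv> density lborel (\<lambda>t. ennreal (normal_density 0 \<sigma> t))"

text \<open>The map is a planar reflection, and two one-dimensional affine substitutions suffice.
  For \<open>s \<noteq> 0\<close> replace \<open>y\<close> by \<open>u = c * x + s * y\<close>,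
  which costs the factor \<open>1 / \<bar>s\<bar>\<close>; after exchanging the integrals replace
  \<open>x\<close> by \<open>v = (x - c * u) / s\<close>, which gives the factor
  \<open>\<bar>s\<bar>\<close> back. For \<open>s = 0\<close> the coordinates decouple into sign
  changes.\<close>

lemma nn_integral_reflection:
  fixes f :: "real \<Rightarrow> real \<Rightarrow> ennreal"
  assumes [measurable]: "case_prod f \<in> borel_measurable (borel \<Otimes>\<^sub>M borel)" and cs: "c\<^sup>2 + s\<^sup>2 = 1"
  shows "(\<integral>\<^sup>+x. \<integral>\<^sup>+y. f (c * x + s * y) (s * x - c * y) \<partial>lborel \<partial>lborel) =
    (\<integral>\<^sup>+x. \<integral>\<^sup>+y. f x y \<partial>lborel \<partial>lborel)" (is "?L = ?R")
proof (cases "s = 0")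
  case True
  hence "c = 1 \<or> c = -1" using cs by (simp add: power2_eq_1_iff)
  then have c: "c \<noteq> 0" "\<bar>c\<bar> = 1" by auto
  have "?L = (\<integral>\<^sup>+x. \<integral>\<^sup>+y. f (c * x) y \<partial>lborel \<partial>lborel)"
  proof (rule nn_integral_cong)
    fix x :: real
    show "(\<integral>\<^sup>+y. f (c * x + s * y) (s * x - c * y) \<partial>lborel) = (\<integral>\<^sup>+y. f (c * x) y \<partial>lborel)"
      using True c nn_integral_real_affine[of "f (c * x)" "-c" 0] by simp
  qed
  also have "\<dots> = ?R"
    using c nn_integral_real_affine[of "\<lambda>x. \<integral>\<^sup>+y. f x y \<partial>lborel" c 0] by simp
  finally show ?thesis .
next
  case False
  have eq: "s * x - c * ((u - c * x) / s) = (x - c * u) / s" for x u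
  proof -
    have "c * (c * x) + s * (s * x) = (c\<^sup>2 + s\<^sup>2) * x" by (simp add: power2_eq_square algebra_simps)
    then have "c * (c * x) + s * (s * x) = x" using cs by simp
    then show ?thesis using False by (simp add: field_simps)
  qed
  have "?L = (\<integral>\<^sup>+x. \<integral>\<^sup>+u. ennreal \<bar>1/s\<bar> * f u ((x - c * u) / s) \<partial>lborel \<partial>lborel)"
  proof (rule nn_integral_cong)
    fix x :: real
    have "(\<integral>\<^sup>+y. f (c * x + s * y) (s * x - c * y) \<partial>lborel) =
      ennreal \<bar>1/s\<bar> * (\<integral>\<^sup>+u. f (c * x + s * (- (c * x / s) + 1 / s * u)) (s * x - c * (- (c * x / s) + 1 / s * u)) \<partial>lborel)"
      using False by (intro nn_integral_real_affine) auto
    also have "(\<lambda>u. f (c * x + s * (- (c * x / s) + 1 / s * u)) (s * x - c * (- (c * x / s) + 1 / s * u))) =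
      (\<lambda>u. f u ((x - c * u) / s))"
    proof
      fix u
      have "- (c * x / s) + 1 / s * u = (u - c * x) / s" by (simp add: diff_divide_distrib)
      thus "f (c * x + s * (- (c * x / s) + 1 / s * u)) (s * x - c * (- (c * x / s) + 1 / s * u)) = f u ((x - c * u) / s)"
        using False by (simp only: eq) simp
    qed
    finally show "(\<integral>\<^sup>+y. f (c * x + s * y) (s * x - c * y) \<partial>lborel) =
      (\<integral>\<^sup>+u. ennreal \<bar>1/s\<bar> * f u ((x - c * u) / s) \<partial>lborel)"
      by (subst nn_integral_cmult) auto
  qed
  also have "\<dots> = (\<integral>\<^sup>+u. \<integral>\<^sup>+x. ennreal \<bar>1/s\<bar> * f u ((x - c * u) / s) \<partial>lborel \<partial>lborel)"
    by (rule lborel_pair.Fubini') auto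
  also have "\<dots> = ?R"
  proof (rule nn_integral_cong)
    fix u :: real
    have "(\<integral>\<^sup>+x. f u ((x - c * u) / s) \<partial>lborel) = ennreal \<bar>s\<bar> * (\<integral>\<^sup>+v. f u v \<partial>lborel)"
      using False nn_integral_real_affine[of "\<lambda>x. f u ((x - c * u) / s)" s "c * u"] by simp
    moreover have "ennreal \<bar>1/s\<bar> * ennreal \<bar>s\<bar> = 1"
      using False by (simp add: ennreal_mult'[symmetric] abs_mult[symmetric])
    ultimately show "(\<integral>\<^sup>+x. ennreal \<bar>1/s\<bar> * f u ((x - c * u) / s) \<partial>lborel) = (\<integral>\<^sup>+y. f u y \<partial>lborel)"
      by (subst nn_integral_cmult) (auto simp: mult.assoc[symmetric])
  qed
  finally show ?thesis .
qed

text \<open>The product density depends on the Euclidean norm of the point only, and a reflection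
  preserves that norm.\<close>

lemma normal_density_mult_reflection:
  assumes "c\<^sup>2 + s\<^sup>2 = 1"
  shows "normal_density 0 \<sigma> (c * x + s * y) * normal_density 0 \<sigma> (s * x - c * y) =
    normal_density 0 \<sigma> x * normal_density 0 \<sigma> y"
proof -
  have "(c * x + s * y)\<^sup>2 + (s * x - c * y)\<^sup>2 = (c\<^sup>2 + s\<^sup>2) * (x\<^sup>2 + y\<^sup>2)"
    by (simp add: power2_eq_square algebra_simps)
  hence "(c * x + s * y)\<^sup>2 + (s * x - c * y)\<^sup>2 = x\<^sup>2 + y\<^sup>2" using assms by simp
  hence "- (c * x + s * y)\<^sup>2 / (2 * \<sigma>\<^sup>2) + - (s * x - c * y)\<^sup>2 / (2 * \<sigma>\<^sup>2) =
     - x\<^sup>2 / (2 * \<sigma>\<^sup>2) + - y\<^sup>2 / (2 * \<sigma>\<^sup>2)"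
    unfolding add_divide_distrib[symmetric] by (intro arg_cong2[where f="(/)"]) auto
  hence "exp (- (c * x + s * y)\<^sup>2 / (2 * \<sigma>\<^sup>2)) * exp (- (s * x - c * y)\<^sup>2 / (2 * \<sigma>\<^sup>2)) =
     exp (- x\<^sup>2 / (2 * \<sigma>\<^sup>2)) * exp (- y\<^sup>2 / (2 * \<sigma>\<^sup>2))"
    unfolding exp_add[symmetric] by (rule arg_cong)
  thus ?thesis by (simp add: normal_density_def)
qed

lemma nn_integral_normal_reflection:
  fixes f :: "real \<Rightarrow> real \<Rightarrow> ennreal"
  assumes [measurable]: "case_prod f \<in> borel_measurable (borel \<Otimes>\<^sub>M borel)" and cs: "c\<^sup>2 + s\<^sup>2 = 1"
  shows "(\<integral>\<^sup>+x. \<integral>\<^sup>+y. f (c * x + s * y) (s * x - c * y) \<partial>normal_law \<sigma> \<partial>normal_law \<sigma>) =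
    (\<integral>\<^sup>+x. \<integral>\<^sup>+y. f x y \<partial>normal_law \<sigma> \<partial>normal_law \<sigma>)"
proof -
  let ?n = "\<lambda>x. ennreal (normal_density 0 \<sigma> x)"
  have *: "(\<integral>\<^sup>+x. \<integral>\<^sup>+y. g x y \<partial>normal_law \<sigma> \<partial>normal_law \<sigma>) =
    (\<integral>\<^sup>+x. \<integral>\<^sup>+y. ennreal (normal_density 0 \<sigma> x * normal_density 0 \<sigma> y) * g x y \<partial>lborel \<partial>lborel)"
    if [measurable]: "case_prod g \<in> borel_measurable (borel \<Otimes>\<^sub>M borel)" for g
  proof -
    have "(\<integral>\<^sup>+x. \<integral>\<^sup>+y. g x y \<partial>normal_law \<sigma> \<partial>normal_law \<sigma>) =
      (\<integral>\<^sup>+x. ?n x * (\<integral>\<^sup>+y. ?n y * g x y \<partial>lborel) \<partial>lborel)"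
      by (simp add: nn_integral_density)
    also have "\<dots> = (\<integral>\<^sup>+x. \<integral>\<^sup>+y. ?n x * (?n y * g x y) \<partial>lborel \<partial>lborel)"
      by (intro nn_integral_cong nn_integral_cmult[symmetric]) measurable
    finally show ?thesis by (simp add: ennreal_mult mult.assoc)
  qed
  have m: "(\<lambda>(x, y). ennreal (normal_density 0 \<sigma> x * normal_density 0 \<sigma> y) * f x y) \<in>
      borel_measurable (borel \<Otimes>\<^sub>M borel)"
    "(\<lambda>(x, y). f (c * x + s * y) (s * x - c * y)) \<in> borel_measurable (borel \<Otimes>\<^sub>M borel)"
    by measurable
  show ?thesis
    unfolding *[OF assms(1)] *[OF m(2)]
    using nn_integral_reflection[OF m(1) cs] unfolding normal_density_mult_reflection[OF cs] .
qed

lemma nn_integral_normal_uminus: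
  assumes [measurable]: "f \<in> borel_measurable borel"
  shows "(\<integral>\<^sup>+x. f (- x) \<partial>normal_law \<sigma>) = (\<integral>\<^sup>+x. f x \<partial>normal_law \<sigma>)"
  using nn_integral_real_affine[of "\<lambda>x. ennreal (normal_density 0 \<sigma> x) * f x" "-1" 0]
  by (simp add: nn_integral_density normal_density_def)

section \<open>Orthogonal maps acting on the product law\<close>

abbreviation iid_normal :: "nat \<Rightarrow> real \<Rightarrow> (nat \<Rightarrow> real) measure" where
  "iid_normal n \<sigma> \<equiv> \<Pi>\<^sub>M i\<in>{..<n}. normal_law \<sigma>"

text \<open>Acts in the plane of the coordinates \<open>k\<close> and \<open>j\<close> by the matrix
  with rows \<open>(c, s)\<close> and \<open>(s, -c)\<close>. A reflection is preferred to a Givens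
  rotation because it is its own inverse.\<close>

definition reflect :: "nat \<Rightarrow> nat \<Rightarrow> real \<Rightarrow> real \<Rightarrow> (nat \<Rightarrow> real) \<Rightarrow> nat \<Rightarrow> real" where
  "reflect k j c s x = x(k := c * x k + s * x j, j := s * x k - c * x j)"

text \<open>The restriction makes the value \<open>undefined\<close> outside \<open>{..<n}\<close>,
  as it is for the points of a product measure over \<open>{..<n}\<close>.\<close>

definition linear_image :: "nat \<Rightarrow> (nat \<Rightarrow> nat \<Rightarrow> real) \<Rightarrow> (nat \<Rightarrow> real) \<Rightarrow> nat \<Rightarrow> real" where
  "linear_image n q x = (\<lambda>i\<in>{..<n}. \<Sum>j<n. q i j * x j)"

text \<open>Coefficients are plain functions, so that \<open>reflect\<close> applies to a column
  exactly as it does to a sample point.\<close>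

definition orthonormal_columns :: "nat \<Rightarrow> (nat \<Rightarrow> nat \<Rightarrow> real) \<Rightarrow> bool" where
  "orthonormal_columns n q \<longleftrightarrow> (\<forall>j<n. \<forall>l<n. (\<Sum>i<n. q i j * q i l) = (if j = l then 1 else 0))"

lemma measurable_linear_image: "linear_image n q \<in> iid_normal n \<sigma> \<rightarrow>\<^sub>M iid_normal n \<sigma>"
  unfolding linear_image_def by (intro measurable_restrict) (auto intro!: borel_measurable_sum borel_measurable_times measurable_PiM_component_rev)

lemma reflect_reflect:
  assumes "k \<noteq> j" "c\<^sup>2 + s\<^sup>2 = 1"
  shows "reflect k j c s (reflect k j c s x) = x"
proof -
  have *: "c * c * z + s * s * z = z" for z
    using assms(2) by (metis distrib_right mult_1 power2_eq_square)
  have "c * (c * x k + s * x j) + s * (s * x k - c * x j) = x k" "s * (c * x k + s * x j) - c * (s * x k - c * x j) = x j"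
    using *[of "x k"] *[of "x j"] by (simp_all add: algebra_simps)
  then show ?thesis using assms(1) by (auto simp: reflect_def fun_eq_iff)
qed

lemma sum_reflect_mult_reflect:
  assumes "k < n" "j < n" "k \<noteq> j" "c\<^sup>2 + s\<^sup>2 = 1"
  shows "(\<Sum>i<n. reflect k j c s u i * reflect k j c s v i) = (\<Sum>i<n. u i * v i)"
proof -
  have split: "(\<Sum>i<n. h i) = h k + (h j + (\<Sum>i\<in>{..<n} - {k} - {j}. h i))" for h :: "nat \<Rightarrow> real"
    using assms by (subst sum.remove[of _ k], simp, simp, subst sum.remove[of _ j]) auto
  have "(\<Sum>i\<in>{..<n} - {k} - {j}. reflect k j c s u i * reflect k j c s v i) = (\<Sum>i\<in>{..<n} - {k} - {j}. u i * v i)"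
    by (intro sum.cong) (auto simp: reflect_def)
  moreover have "reflect k j c s u k * reflect k j c s v k + reflect k j c s u j * reflect k j c s v j =
     (c\<^sup>2 + s\<^sup>2) * (u k * v k + u j * v j)"
    using assms(3) by (simp add: reflect_def power2_eq_square algebra_simps)
  ultimately show ?thesis unfolding split using assms(4) by simp
qed

lemma linear_image_reflect:
  assumes "k < n" "j < n"
  shows "linear_image n (\<lambda>i l. reflect k j c s (\<lambda>i. q i l) i) x = reflect k j c s (linear_image n q x)"
  using assms by (auto simp: linear_image_def reflect_def fun_eq_iff sum.distrib sum_subtractf sum_distrib_left algebra_simps)

text \<open>Since \<open>f x = T (T (f x))\<close>, the law of \<open>f\<close> is the image under
  \<open>T\<close> of the law of \<open>T\<close> after \<open>f\<close>. This carries the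
  conclusion back from a simplified coefficient array to the original one.\<close>

lemma distr_involution_cancel:
  assumes T: "T \<in> N \<rightarrow>\<^sub>M N" "distr N N T = N" and inv: "\<And>x. T (T x) = x"
    and f: "f \<in> N \<rightarrow>\<^sub>M N" and Tf: "distr N N (\<lambda>x. T (f x)) = N"
  shows "distr N N f = N"
proof -
  have "distr N N f = distr (distr N N (\<lambda>x. T (f x))) N T"
    using measurable_compose[OF f T(1)] by (subst distr_distr[OF T(1)]) (auto simp: comp_def inv)
  then show ?thesis using Tf T(2) by simp
qed

context
  fixes \<sigma> :: real
  assumes \<sigma>: "\<sigma> > 0"
begin

lemma measurable_reflect:
  assumes "k < n" "j < n"
  shows "reflect k j c s \<in> iid_normal n \<sigma> \<rightarrow>\<^sub>M iid_normal n \<sigma>"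
proof -
  \<comment> \<open>\<open>measurable_fun_upd\<close> expects the index set as a union with the
    updated index, which here already belongs to it.\<close>
  have I: "{..<n} = {..<n} \<union> {k}" "{..<n} = {..<n} \<union> {j}" using assms by auto
  have [measurable]: "(\<lambda>x. x k) \<in> borel_measurable (iid_normal n \<sigma>)" "(\<lambda>x. x j) \<in> borel_measurable (iid_normal n \<sigma>)"
    using assms by (auto intro!: measurable_PiM_component_rev)
  show ?thesis
    unfolding reflect_def
    by (rule measurable_fun_upd[OF I(2)], rule measurable_fun_upd[OF I(1)]) measurable
qed

lemma measurable_uminus_coordinate:
  assumes "k < n"
  shows "(\<lambda>x. x(k := - x k)) \<in> iid_normal n \<sigma> \<rightarrow>\<^sub>M iid_normal n \<sigma>"
proof -
  have I: "{..<n} = {..<n} \<union> {k}" using assms by auto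
  have [measurable]: "(\<lambda>x. x k) \<in> borel_measurable (iid_normal n \<sigma>)"
    using assms by (auto intro!: measurable_PiM_component_rev)
  show ?thesis
    by (rule measurable_fun_upd[OF I]) measurable
qed

text \<open>By Fubini the coordinates \<open>k\<close> and \<open>j\<close> are integrated
  innermost; with the others held fixed, the claim for an indicator is the planar identity
  \<open>nn_integral_normal_reflection\<close>.\<close>

lemma distr_reflect:
  assumes kj: "k < n" "j < n" "k \<noteq> j" and cs: "c\<^sup>2 + s\<^sup>2 = 1"
  shows "distr (iid_normal n \<sigma>) (iid_normal n \<sigma>) (reflect k j c s) = iid_normal n \<sigma>"
proof (rule measure_eqI)
  interpret N: prob_space "normal_law \<sigma>" using prob_space_normal_density[OF \<sigma>] .
  interpret product_sigma_finite "\<lambda>_::nat. normal_law \<sigma>" by unfold_locales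
  define J where "J = {..<n} - {k, j}"
  let ?P = "\<Pi>\<^sub>M i\<in>J. normal_law \<sigma>"
  have I: "{..<n} = insert j (insert k J)" and J: "finite J" "k \<notin> J" "j \<notin> insert k J"
    using kj by (auto simp: J_def)
  have upd [measurable]: "(\<lambda>(x, a, b). x(k := a, j := b)) \<in> ?P \<Otimes>\<^sub>M borel \<Otimes>\<^sub>M borel \<rightarrow>\<^sub>M iid_normal n \<sigma>"
    unfolding I split_beta
    by (rule measurable_fun_upd[where J="insert k J"], force, rule measurable_fun_upd[where J="J"]) auto
  have ins: "(\<integral>\<^sup>+x. g x \<partial>iid_normal n \<sigma>) =
    (\<integral>\<^sup>+x. \<integral>\<^sup>+a. \<integral>\<^sup>+b. g (x(k := a, j := b)) \<partial>normal_law \<sigma> \<partial>normal_law \<sigma> \<partial>?P)"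
    if g [measurable]: "g \<in> borel_measurable (iid_normal n \<sigma>)" for g :: "_ \<Rightarrow> ennreal"
  proof -
    have g' [measurable]: "g \<in> borel_measurable (Pi\<^sub>M (insert j (insert k J)) (\<lambda>i. normal_law \<sigma>))"
      using g I by simp
    have "(\<integral>\<^sup>+x. g x \<partial>iid_normal n \<sigma>) =
      (\<integral>\<^sup>+x. \<integral>\<^sup>+b. g (x(j := b)) \<partial>normal_law \<sigma> \<partial>Pi\<^sub>M (insert k J) (\<lambda>i. normal_law \<sigma>))"
      unfolding I by (rule product_nn_integral_insert[OF _ _ g']) (use J in auto)
    also have "\<dots> = (\<integral>\<^sup>+x. \<integral>\<^sup>+a. \<integral>\<^sup>+b. g (x(k := a, j := b)) \<partial>normal_law \<sigma> \<partial>normal_law \<sigma> \<partial>?P)"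
      by (rule product_nn_integral_insert) (use J in simp_all, measurable)
    finally show ?thesis .
  qed
  fix X assume "X \<in> sets (distr (iid_normal n \<sigma>) (iid_normal n \<sigma>) (reflect k j c s))"
  then have X [measurable]: "X \<in> sets (iid_normal n \<sigma>)" by simp
  note [measurable] = measurable_reflect[OF kj(1,2)]
  have "emeasure (distr (iid_normal n \<sigma>) (iid_normal n \<sigma>) (reflect k j c s)) X =
    (\<integral>\<^sup>+x. indicator X (reflect k j c s x) \<partial>iid_normal n \<sigma>)"
    by (simp add: nn_integral_indicator[symmetric] nn_integral_distr del: nn_integral_indicator)
  also have "\<dots> = (\<integral>\<^sup>+x. indicator X x \<partial>iid_normal n \<sigma>)"
  proof -
    have "(\<integral>\<^sup>+a. \<integral>\<^sup>+b. indicator X (reflect k j c s (x(k := a, j := b))) \<partial>normal_law \<sigma> \<partial>normal_law \<sigma>) =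
        (\<integral>\<^sup>+a. \<integral>\<^sup>+b. indicator X (x(k := a, j := b)) \<partial>normal_law \<sigma> \<partial>normal_law \<sigma>)"
      if x: "x \<in> space ?P" for x
    proof -
      have "(\<lambda>(a, b). x(k := a, j := b)) \<in> borel \<Otimes>\<^sub>M borel \<rightarrow>\<^sub>M iid_normal n \<sigma>"
        using measurable_Pair2[OF upd x] by (simp add: split_beta)
      then have "(\<lambda>(a, b). indicator X (x(k := a, j := b)) :: ennreal) \<in> borel_measurable (borel \<Otimes>\<^sub>M borel)"
        unfolding split_beta by measurable
      from nn_integral_normal_reflection[OF this cs, of \<sigma>]
      show ?thesis using kj(3) by (simp add: reflect_def fun_upd_twist)
    qed
    then show ?thesis
      by (subst (1 2) ins) (measurable, rule nn_integral_cong)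
  qed
  finally show "emeasure (distr (iid_normal n \<sigma>) (iid_normal n \<sigma>) (reflect k j c s)) X = emeasure (iid_normal n \<sigma>) X"
    by simp
qed simp


text \<open>Needed because a column with nothing left to eliminate may carry \<open>-1\<close> on
  the diagonal.\<close>

lemma distr_uminus_coordinate:
  assumes k: "k < n"
  shows "distr (iid_normal n \<sigma>) (iid_normal n \<sigma>) (\<lambda>x. x(k := - x k)) = iid_normal n \<sigma>"
proof (rule measure_eqI)
  interpret N: prob_space "normal_law \<sigma>" using prob_space_normal_density[OF \<sigma>] .
  interpret product_sigma_finite "\<lambda>_::nat. normal_law \<sigma>" by unfold_locales
  define J where "J = {..<n} - {k}"
  let ?P = "\<Pi>\<^sub>M i\<in>J. normal_law \<sigma>"
  have I: "{..<n} = insert k J" and J: "finite J" "k \<notin> J" using k by (auto simp: J_def)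
  fix X assume "X \<in> sets (distr (iid_normal n \<sigma>) (iid_normal n \<sigma>) (\<lambda>x. x(k := - x k)))"
  then have X [measurable]: "X \<in> sets (iid_normal n \<sigma>)" by simp
  then have X' [measurable]: "X \<in> sets (\<Pi>\<^sub>M i\<in>insert k J. normal_law \<sigma>)" using I by simp
  note [measurable] = measurable_uminus_coordinate[OF k]
  have "emeasure (distr (iid_normal n \<sigma>) (iid_normal n \<sigma>) (\<lambda>x. x(k := - x k))) X =
    (\<integral>\<^sup>+x. indicator X (x(k := - x k)) \<partial>iid_normal n \<sigma>)"
    by (simp add: nn_integral_indicator[symmetric] nn_integral_distr del: nn_integral_indicator)
  also have "\<dots> = (\<integral>\<^sup>+x. \<integral>\<^sup>+a. indicator X (x(k := - a)) \<partial>normal_law \<sigma> \<partial>?P)"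
    using measurable_uminus_coordinate[OF k]
    unfolding I by (subst product_nn_integral_insert) (use J in simp_all)
  also have "\<dots> = (\<integral>\<^sup>+x. \<integral>\<^sup>+a. indicator X (x(k := a)) \<partial>normal_law \<sigma> \<partial>?P)"
  proof (rule nn_integral_cong)
    fix x assume x: "x \<in> space ?P"
    have "(\<lambda>a. x(k := a)) \<in> borel \<rightarrow>\<^sub>M (\<Pi>\<^sub>M i\<in>insert k J. normal_law \<sigma>)"
      using x by (intro measurable_fun_upd[where J="J"]) auto
    then have "(\<lambda>a. indicator X (x(k := a)) :: ennreal) \<in> borel_measurable borel"
      by measurable
    from nn_integral_normal_uminus[OF this]
    show "(\<integral>\<^sup>+a. indicator X (x(k := - a)) \<partial>normal_law \<sigma>) = (\<integral>\<^sup>+a. indicator X (x(k := a)) \<partial>normal_law \<sigma>)"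
      by simp
  qed
  also have "\<dots> = (\<integral>\<^sup>+x. indicator X x \<partial>iid_normal n \<sigma>)"
    unfolding I by (subst product_nn_integral_insert) (use J in simp_all)
  finally show "emeasure (distr (iid_normal n \<sigma>) (iid_normal n \<sigma>) (\<lambda>x. x(k := - x k))) X = emeasure (iid_normal n \<sigma>) X"
    by simp
qed simp

text \<open>Givens elimination: reflections in coordinate planes turn the columns one after the other
  into unit vectors.\<close>

lemma distr_linear_image_partial:
  assumes "k \<le> n" "orthonormal_columns n q" "\<And>i j. i < n \<Longrightarrow> j < k \<Longrightarrow> q i j = (if i = j then 1 else 0)"
  shows "distr (iid_normal n \<sigma>) (iid_normal n \<sigma>) (linear_image n q) = iid_normal n \<sigma>"
  using assms
proof (induction "n - k" arbitrary: k q)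
  case 0
  then have [simp]: "k = n" by simp
  \<comment> \<open>True only on the space of the product measure, whose points are
    \<open>undefined\<close> beyond \<open>n\<close> just like the values of
    \<open>linear_image\<close>.\<close>
  have "linear_image n q x = x" if "x \<in> space (iid_normal n \<sigma>)" for x
  proof
    fix i show "linear_image n q x i = x i"
      using that 0(4) by (cases "i < n") (auto simp: linear_image_def space_PiM PiE_def extensional_def if_distrib[of "\<lambda>z. z * _"] cong: if_cong)
  qed
  then show ?case
    by (subst distr_cong[where g="\<lambda>x. x" and L="iid_normal n \<sigma>"]) (auto simp: distr_id)
next
  case (Suc d)
  then have k: "k < n" "d = n - Suc k" by auto
  note outer = Suc.hyps(1)[OF k(2)]
  from Suc.prems(2,3) show ?case
  \<comment> \<open>The inner induction counts the nonzero entries below the diagonal in column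
    \<open>k\<close>. A reflection removes one of them and creates none, since apart from row
    \<open>j\<close> it changes only the diagonal row \<open>k\<close>.\<close>
  proof (induction "card {j. k < j \<and> j < n \<and> q j k \<noteq> 0}" arbitrary: q rule: less_induct)
    case less
    note orth = less.prems(1)[unfolded orthonormal_columns_def, rule_format]
    \<comment> \<open>Column \<open>k\<close> is orthogonal to column \<open>i\<close>, which is
      already a unit vector, so nothing has to be eliminated above the diagonal.\<close>
    have zero: "q i k = 0" if "i < k" for i
    proof -
      have "(\<Sum>a<n. q a i * q a k) = (\<Sum>a<n. if a = i then q a k else 0)"
        using less.prems(2) that k by (intro sum.cong) auto
      then show ?thesis using orth[of i k] that k by simp
    qed
    show ?case
    proof (cases "\<exists>j. k < j \<and> j < n \<and> q j k \<noteq> 0")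
      case True
      then obtain j where j: "k < j" "j < n" "q j k \<noteq> 0" by auto
      \<comment> \<open>The normalised entries \<open>c\<close> and \<open>s\<close> satisfy
        \<open>s * q k k - c * q j k = 0\<close>, so the reflection annihilates the entry in row
        \<open>j\<close>.\<close>
      define r where "r = sqrt ((q k k)\<^sup>2 + (q j k)\<^sup>2)"
      have r2: "r\<^sup>2 = (q k k)\<^sup>2 + (q j k)\<^sup>2" by (simp add: r_def)
      have r: "r \<noteq> 0" using j(3) by (simp add: r_def sum_power2_eq_zero_iff)
      define c s where "c = q k k / r" "s = q j k / r"
      have cs: "c\<^sup>2 + s\<^sup>2 = 1"
        using r by (simp add: c_s_def power_divide add_divide_distrib[symmetric] r2[symmetric])
      let ?q = "\<lambda>i l. reflect k j c s (\<lambda>i. q i l) i"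
      have q0: "?q j k = 0" using j by (simp add: reflect_def c_s_def)
      have "distr (iid_normal n \<sigma>) (iid_normal n \<sigma>) (linear_image n ?q) = iid_normal n \<sigma>"
      proof (rule less.hyps)
        show "card {i. k < i \<and> i < n \<and> ?q i k \<noteq> 0} < card {i. k < i \<and> i < n \<and> q i k \<noteq> 0}"
          using j q0 by (intro psubset_card_mono) (auto simp: reflect_def split: if_splits)
        show "orthonormal_columns n ?q"
          using less.prems(1)
          unfolding orthonormal_columns_def sum_reflect_mult_reflect[OF k(1) j(2) less_imp_neq[OF j(1)] cs] .
        \<comment> \<open>The finished columns vanish in rows \<open>k\<close> and \<open>j\<close>,
          hence the reflection leaves them alone.\<close>
        show "?q i l = (if i = l then 1 else 0)" if "i < n" "l < k" for i l
          using that less.prems(2)[of _ l] j k by (auto simp: reflect_def)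
      qed
      moreover have "linear_image n ?q = (\<lambda>x. reflect k j c s (linear_image n q x))"
        by (rule ext, rule linear_image_reflect[OF k(1) j(2)])
      ultimately have *: "distr (iid_normal n \<sigma>) (iid_normal n \<sigma>) (\<lambda>x. reflect k j c s (linear_image n q x)) = iid_normal n \<sigma>"
        by (simp only:)
      show ?thesis
        by (rule distr_involution_cancel[OF measurable_reflect[OF k(1) j(2)] distr_reflect[OF k(1) j(2) less_imp_neq[OF j(1)] cs]
              reflect_reflect[OF less_imp_neq[OF j(1)] cs] measurable_linear_image *])
    next
      case False
      have qk: "q a k = 0" if "a < n" "a \<noteq> k" for a
        using that zero False by (meson linorder_neqE_nat)
      have colk: "(\<Sum>a<n. q a k * q a l) = q k k * q k l" for l
      proof -
        have "(\<Sum>a<n. q a k * q a l) = (\<Sum>a<n. if a = k then q k k * q k l else 0)"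
          by (rule sum.cong) (simp_all add: qk)
        then show ?thesis using k by simp
      qed
      then have "q k k * q k k = 1" using orth[of k k] k by simp
      then have "q k k = 1 \<or> q k k = -1" by (simp add: square_eq_1_iff)
      then show ?thesis
      proof
        assume "q k k = 1"
        then show ?thesis
        proof (intro outer)
          show "q i j = (if i = j then 1 else 0)" if "i < n" "j < Suc k" for i j
            using that \<open>q k k = 1\<close> qk[of i] less.prems(2)[of i j] by (cases "j = k") (simp_all add: less_Suc_eq)
        qed (use k less.prems(1) in auto)
      next
        assume q: "q k k = -1"
        let ?q = "\<lambda>i l. if i = k then - q i l else q i l"
        have "distr (iid_normal n \<sigma>) (iid_normal n \<sigma>) (linear_image n ?q) = iid_normal n \<sigma>"
        proof (rule outer)
          have "(if i = k then - q i j else q i j) * (if i = k then - q i l else q i l) = q i j * q i l" for i j l by simp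
          then show "orthonormal_columns n ?q" using less.prems(1) by (simp add: orthonormal_columns_def)
          show "?q i j = (if i = j then 1 else 0)" if "i < n" "j < Suc k" for i j
            using that k q qk[of i] less.prems(2)[of i j]
            by (cases "j = k"; cases "i = k") (auto simp: less_Suc_eq split: if_splits)
        qed (use k in auto)
        moreover have "linear_image n ?q = (\<lambda>x. (linear_image n q x)(k := - linear_image n q x k))"
          using k by (auto simp: linear_image_def fun_eq_iff sum_negf)
        ultimately have *: "distr (iid_normal n \<sigma>) (iid_normal n \<sigma>) (\<lambda>x. (linear_image n q x)(k := - linear_image n q x k)) = iid_normal n \<sigma>"
          by (simp only:)
        show ?thesis
          by (rule distr_involution_cancel[OF measurable_uminus_coordinate[OF k(1)] distr_uminus_coordinate[OF k(1)]
                _ measurable_linear_image *]) (simp add: fun_eq_iff)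
      qed
    qed
  qed
qed

lemma distr_linear_image:
  assumes "orthonormal_columns n q"
  shows "distr (iid_normal n \<sigma>) (iid_normal n \<sigma>) (linear_image n q) = iid_normal n \<sigma>"
  using distr_linear_image_partial[of 0] assms by simp

end

subsection \<open>The maximal inequality\<close>

text \<open>Defined for a deterministic sequence, so that measurability and independence of the
  random version follow by composition with the coordinates.\<close>

primrec stopped_sum :: "real \<Rightarrow> (nat \<Rightarrow> real) \<Rightarrow> nat \<Rightarrow> real" where
  "stopped_sum t x 0 = 0"
| "stopped_sum t x (Suc k) = stopped_sum t x k + (if \<bar>stopped_sum t x k\<bar> \<le> t then x k else 0)"

lemma stopped_sum_cong: "(\<And>i. i < k \<Longrightarrow> x i = y i) \<Longrightarrow> stopped_sum t x k = stopped_sum t y k"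
  by (induction k) auto

text \<open>Up to the first exit the stopped sum is the partial sum itself, and at the exit it
  freezes at a value beyond \<open>t\<close>. The induction has to carry both facts in one
  invariant.\<close>

lemma stopped_sum_exceeds_iff:
  "t < \<bar>stopped_sum t x k\<bar> \<longleftrightarrow> (\<exists>j\<le>k. t < \<bar>\<Sum>i<j. x i\<bar>)"
proof -
  have "(if \<exists>j\<le>k. t < \<bar>\<Sum>i<j. x i\<bar> then t < \<bar>stopped_sum t x k\<bar> else stopped_sum t x k = (\<Sum>i<k. x i))"
    by (induction k) (auto simp: le_Suc_eq split: if_splits)
  then show ?thesis by (auto split: if_splits)
qed

lemma borel_measurable_stopped_sum [measurable]:
  "k \<le> n \<Longrightarrow> (\<lambda>x. stopped_sum t x k) \<in> borel_measurable (\<Pi>\<^sub>M i\<in>{..<n}. borel)"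
proof (induction k)
  case (Suc k)
  have [measurable]: "(\<lambda>x. x k) \<in> borel_measurable (\<Pi>\<^sub>M i\<in>{..<n}. (borel :: real measure))"
    using Suc.prems by (auto intro!: measurable_PiM_component_rev)
  have [measurable]: "(\<lambda>x. stopped_sum t x k) \<in> borel_measurable (\<Pi>\<^sub>M i\<in>{..<n}. borel)"
    using Suc by simp
  show ?case by simp
qed simp

context prob_space
begin

text \<open>The partial sums are stopped at the first exit from \<open>[-t, t]\<close>. Whether a summand is still
  added depends on the earlier ones only, so the stopped sum has at most the variance of the full
  sum, and it remembers every exit.\<close>

lemma expectation_stopped_sum_square:
  fixes X :: "nat \<Rightarrow> 'a \<Rightarrow> real"
  assumes indep: "indep_vars (\<lambda>_. borel) X {..<n}"
    and int: "\<And>i. i < n \<Longrightarrow> integrable M (\<lambda>\<omega>. (X i \<omega>)\<^sup>2)"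
    and zero: "\<And>i. i < n \<Longrightarrow> expectation (X i) = 0"
    and k: "k \<le> n"
  shows "integrable M (\<lambda>\<omega>. (stopped_sum t (\<lambda>i. X i \<omega>) k)\<^sup>2) \<and>
    expectation (\<lambda>\<omega>. (stopped_sum t (\<lambda>i. X i \<omega>) k)\<^sup>2) \<le> (\<Sum>i<k. expectation (\<lambda>\<omega>. (X i \<omega>)\<^sup>2))"
  using k
proof (induction k)
  case (Suc k)
  then have k: "k < n" by simp
  define U where "U \<omega> = stopped_sum t (\<lambda>i. X i \<omega>) k" for \<omega>
  define V where "V \<omega> = (if \<bar>U \<omega>\<bar> \<le> t then 1 else 0 :: real)" for \<omega>
  have IH: "integrable M (\<lambda>\<omega>. (U \<omega>)\<^sup>2)" "expectation (\<lambda>\<omega>. (U \<omega>)\<^sup>2) \<le> (\<Sum>i<k. expectation (\<lambda>\<omega>. (X i \<omega>)\<^sup>2))"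
    using Suc by (auto simp: U_def)
  have X [measurable]: "X i \<in> borel_measurable M" if "i < n" for i
    using indep that by (auto simp: indep_vars_def)
  have [measurable]: "X k \<in> borel_measurable M" using X k .
  have intX: "integrable M (X k)" using square_integrable_imp_integrable[OF _ int[OF k]] by simp
  \<comment> \<open>The stopped sum reads only the indices in \<open>{..<k}\<close>, which are
    disjoint from \<open>{k}\<close>; so \<open>X k\<close> is independent of \<open>U\<close> times
    \<open>V\<close>.\<close>
  let ?F = "\<lambda>x. stopped_sum t x k * (if \<bar>stopped_sum t x k\<bar> \<le> t then 1 else 0)"
  have indep': "indep_var borel ((\<lambda>x. x k) \<circ> (\<lambda>\<omega>. restrict (\<lambda>i. X i \<omega>) {k}))
     borel (?F \<circ> (\<lambda>\<omega>. restrict (\<lambda>i. X i \<omega>) {..<k}))"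
    by (intro indep_var_compose[OF indep_var_restrict[OF indep]]) (use k in \<open>auto intro!: measurable_PiM_component_rev\<close>)
  have "((\<lambda>x. x k) \<circ> (\<lambda>\<omega>. restrict (\<lambda>i. X i \<omega>) {k})) = X k" by auto
  moreover have "(?F \<circ> (\<lambda>\<omega>. restrict (\<lambda>i. X i \<omega>) {..<k})) = (\<lambda>\<omega>. U \<omega> * V \<omega>)"
  proof
    fix \<omega>
    have "stopped_sum t (restrict (\<lambda>i. X i \<omega>) {..<k}) k = U \<omega>"
      unfolding U_def by (rule stopped_sum_cong) auto
    then show "(?F \<circ> (\<lambda>\<omega>. restrict (\<lambda>i. X i \<omega>) {..<k})) \<omega> = U \<omega> * V \<omega>" by (simp add: V_def)
  qed
  ultimately have ind: "indep_var borel (X k) borel (\<lambda>\<omega>. U \<omega> * V \<omega>)" using indep' by simp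
  have UVm: "(\<lambda>\<omega>. U \<omega> * V \<omega>) \<in> borel_measurable M" using indep_var_rv2[OF ind] .
  have Um [measurable]: "U \<in> borel_measurable M"
  proof -
    have "(\<lambda>\<omega>. stopped_sum t (restrict (\<lambda>i. X i \<omega>) {..<k}) k) \<in> borel_measurable M"
      using k by (intro measurable_compose[OF _ borel_measurable_stopped_sum[OF order_refl]] measurable_restrict) auto
    also have "(\<lambda>\<omega>. stopped_sum t (restrict (\<lambda>i. X i \<omega>) {..<k}) k) = U"
      unfolding U_def by (intro ext stopped_sum_cong) auto
    finally show ?thesis .
  qed
  have Vm [measurable]: "V \<in> borel_measurable M" unfolding V_def by measurable
  \<comment> \<open>\<open>V\<close> vanishes where \<open>\<bar>U \<omega>\<bar>\<close> exceeds
    \<open>t\<close>, so the product is bounded.\<close>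
  have intUV: "integrable M (\<lambda>\<omega>. U \<omega> * V \<omega>)"
    by (rule integrable_const_bound[where B="\<bar>t\<bar>"]) (auto simp: V_def)
  have cross: "integrable M (\<lambda>\<omega>. X k \<omega> * (U \<omega> * V \<omega>))" "expectation (\<lambda>\<omega>. X k \<omega> * (U \<omega> * V \<omega>)) = 0"
    using indep_var_integrable[OF ind intX intUV] indep_var_lebesgue_integral[OF ind intX intUV] zero[OF k] by auto
  have last: "integrable M (\<lambda>\<omega>. V \<omega> * (X k \<omega>)\<^sup>2)"
    by (rule Bochner_Integration.integrable_bound[OF int[OF k]]) (auto simp: V_def)
  have le: "expectation (\<lambda>\<omega>. V \<omega> * (X k \<omega>)\<^sup>2) \<le> expectation (\<lambda>\<omega>. (X k \<omega>)\<^sup>2)"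
    by (rule integral_mono[OF last int[OF k]]) (auto simp: V_def)
  \<comment> \<open>\<open>V\<close> takes the values 0 and 1 only, so its square is
    \<open>V\<close> itself.\<close>
  have eq: "(\<lambda>\<omega>. (stopped_sum t (\<lambda>i. X i \<omega>) (Suc k))\<^sup>2) =
    (\<lambda>\<omega>. (U \<omega>)\<^sup>2 + 2 * (X k \<omega> * (U \<omega> * V \<omega>)) + V \<omega> * (X k \<omega>)\<^sup>2)"
    by (auto simp: fun_eq_iff U_def V_def power2_sum)
  show ?case
    unfolding eq using IH cross last le by simp
qed simp

text \<open>An exit at any time up to \<open>n\<close> is still visible in the stopped sum at time
  \<open>n\<close>, so Chebyshev's inequality at that single time is enough.\<close>

lemma kolmogorov_maximal_inequality:
  fixes X :: "nat \<Rightarrow> 'a \<Rightarrow> real"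
  assumes indep: "indep_vars (\<lambda>_. borel) X {..<n}"
    and int: "\<And>i. i < n \<Longrightarrow> integrable M (\<lambda>\<omega>. (X i \<omega>)\<^sup>2)"
    and zero: "\<And>i. i < n \<Longrightarrow> expectation (X i) = 0"
    and t: "t > 0"
  shows "prob {\<omega> \<in> space M. \<exists>k\<le>n. t < \<bar>\<Sum>i<k. X i \<omega>\<bar>} \<le> (\<Sum>i<n. expectation (\<lambda>\<omega>. (X i \<omega>)\<^sup>2)) / t\<^sup>2"
proof -
  let ?W = "\<lambda>\<omega>. stopped_sum t (\<lambda>i. X i \<omega>) n"
  note W = expectation_stopped_sum_square[OF indep int zero order_refl, of t]
  have "{\<omega> \<in> space M. \<exists>k\<le>n. t < \<bar>\<Sum>i<k. X i \<omega>\<bar>} \<subseteq> {\<omega> \<in> space M. t\<^sup>2 \<le> (?W \<omega>)\<^sup>2}"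
    using t by (auto simp: stopped_sum_exceeds_iff[symmetric] abs_le_square_iff[symmetric])
  then have "prob {\<omega> \<in> space M. \<exists>k\<le>n. t < \<bar>\<Sum>i<k. X i \<omega>\<bar>} \<le> prob {\<omega> \<in> space M. t\<^sup>2 \<le> (?W \<omega>)\<^sup>2}"
    using W by (intro finite_measure_mono) auto
  also have "\<dots> \<le> expectation (\<lambda>\<omega>. (?W \<omega>)\<^sup>2) / t\<^sup>2"
    using W t by (intro integral_Markov_inequality_measure[where A="{}"]) auto
  also have "\<dots> \<le> (\<Sum>i<n. expectation (\<lambda>\<omega>. (X i \<omega>)\<^sup>2)) / t\<^sup>2"
    using W by (intro divide_right_mono) auto
  finally show ?thesis .
qed

end

section \<open>Countable suprema and summation by parts\<close>

text \<open>Serves the measurability of the supremum over \<alpha>. Each point is approached by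
  rationals from the right, which therefore stay in the half-line even at its endpoint.\<close>

lemma SUP_continuous_eq_SUP_rationals:
  fixes g :: "real \<Rightarrow> real"
  assumes g: "continuous_on {a..} g"
  shows "(SUP \<alpha>\<in>{a..}. ereal (g \<alpha>)) = (SUP \<alpha>\<in>{a..} \<inter> \<rat>. ereal (g \<alpha>))"
proof (rule antisym)
  show "(SUP \<alpha>\<in>{a..}. ereal (g \<alpha>)) \<le> (SUP \<alpha>\<in>{a..} \<inter> \<rat>. ereal (g \<alpha>))"
  proof (rule SUP_least)
    fix \<alpha> assume \<alpha>: "\<alpha> \<in> {a..}"
    have "\<exists>q. q \<in> \<rat> \<and> \<alpha> < q \<and> q < \<alpha> + 1 / real (Suc n)" for n
      using Rats_dense_in_real[of \<alpha> "\<alpha> + 1 / real (Suc n)"] by auto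
    then obtain q where q: "q n \<in> \<rat>" "\<alpha> < q n" "q n < \<alpha> + 1 / real (Suc n)" for n by metis
    have "q \<longlonglongrightarrow> \<alpha>"
    proof (rule tendsto_sandwich[of "\<lambda>_. \<alpha>" _ _ "\<lambda>n. \<alpha> + 1 / real (Suc n)"])
      show "(\<lambda>n. \<alpha> + 1 / real (Suc n)) \<longlonglongrightarrow> \<alpha>"
        using tendsto_add[OF tendsto_const LIMSEQ_inverse_real_of_nat, of \<alpha>] by (simp add: inverse_eq_divide)
    qed (use q in \<open>auto intro!: always_eventually less_imp_le\<close>)
    moreover have "q n \<in> {a..}" for n using q(2)[of n] \<alpha> by simp
    ultimately have "(\<lambda>n. g (q n)) \<longlonglongrightarrow> g \<alpha>"
      using \<alpha> by (intro continuous_on_tendsto_compose[OF g]) auto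
    then have "(\<lambda>n. ereal (g (q n))) \<longlonglongrightarrow> ereal (g \<alpha>)" by simp
    moreover have "ereal (g (q n)) \<le> (SUP \<alpha>\<in>{a..} \<inter> \<rat>. ereal (g \<alpha>))" for n
      using q(1,2)[of n] \<alpha> by (intro SUP_upper) auto
    ultimately show "ereal (g \<alpha>) \<le> (SUP \<alpha>\<in>{a..} \<inter> \<rat>. ereal (g \<alpha>))"
      by (intro Lim_bounded[where M=0 and f="\<lambda>n. ereal (g (q n))"]) auto
  qed
qed (rule SUP_subset_mono, auto)

text \<open>Summation by parts writes the weighted sum as a combination of partial sums with the
  nonnegative coefficients \<open>f k - f (k + 1)\<close> and, for the last one,
  \<open>f (n - 1)\<close>. These add up to \<open>f 0\<close>, which is at most 1.\<close>

lemma abs_sum_antimono_mult_le: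
  fixes f x :: "nat \<Rightarrow> real"
  assumes f: "\<And>i j. i \<le> j \<Longrightarrow> j < n \<Longrightarrow> f j \<le> f i" "\<And>i. i < n \<Longrightarrow> 0 \<le> f i" "\<And>i. i < n \<Longrightarrow> f i \<le> 1"
    and S: "\<And>k. k \<le> n \<Longrightarrow> \<bar>\<Sum>i<k. x i\<bar> \<le> B"
  shows "\<bar>\<Sum>i<n. f i * x i\<bar> \<le> B"
proof (cases n)
  case 0
  then show ?thesis using S[of 0] by simp
next
  case (Suc m)
  \<comment> \<open>After splitting off \<open>f k\<close> times the current partial sum, each
    further step costs at most \<open>(f k - f (Suc k)) * B\<close>, and these costs
    telescope.\<close>
  have "\<bar>(\<Sum>i<Suc k. f i * x i) - f k * (\<Sum>i<Suc k. x i)\<bar> \<le> (f 0 - f k) * B" if "k < n" for k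
    using that
  proof (induction k)
    case (Suc k)
    let ?D = "(\<Sum>i<Suc k. f i * x i) - f k * (\<Sum>i<Suc k. x i)"
    have "(\<Sum>i<Suc (Suc k). f i * x i) - f (Suc k) * (\<Sum>i<Suc (Suc k). x i) =
      ?D + (f k - f (Suc k)) * (\<Sum>i<Suc k. x i)"
      by (simp add: algebra_simps)
    moreover have "\<bar>(f k - f (Suc k)) * (\<Sum>i<Suc k. x i)\<bar> \<le> (f k - f (Suc k)) * B"
      using f(1)[of k "Suc k"] S[of "Suc k"] Suc.prems by (simp add: abs_mult mult_left_mono del: sum.lessThan_Suc)
    moreover have "\<bar>?D\<bar> \<le> (f 0 - f k) * B" using Suc by simp
    ultimately show ?case by (simp add: algebra_simps del: sum.lessThan_Suc)
  qed simp
  from this[of m] have 1: "\<bar>(\<Sum>i<n. f i * x i) - f m * (\<Sum>i<n. x i)\<bar> \<le> (f 0 - f m) * B" using Suc by simp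
  have "\<bar>f m * (\<Sum>i<n. x i)\<bar> \<le> f m * B"
    using f(2)[of m] S[of n] Suc by (simp add: abs_mult mult_left_mono del: sum.lessThan_Suc)
  with 1 have "\<bar>\<Sum>i<n. f i * x i\<bar> \<le> f 0 * B" by (simp add: algebra_simps)
  \<comment> \<open>The empty partial sum in \<open>S\<close> supplies
    \<open>0 \<le> B\<close>.\<close>
  also have "\<dots> \<le> 1 * B" using f(3)[of 0] S[of 0] Suc by (intro mult_right_mono) auto
  finally show ?thesis by simp
qed

section \<open>Gaussian moments and the tail bound for monotone filters\<close>

lemma normal_law_moments:
  assumes "\<sigma> > 0"
  shows "integrable (normal_law \<sigma>) (\<lambda>x. x ^ k)"
    and "(\<integral>x. x \<partial>normal_law \<sigma>) = 0" "(\<integral>x. x ^ 2 \<partial>normal_law \<sigma>) = \<sigma>\<^sup>2"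
      "(\<integral>x. x ^ 3 \<partial>normal_law \<sigma>) = 0" "(\<integral>x. x ^ 4 \<partial>normal_law \<sigma>) = 3 * \<sigma> ^ 4"
proof -
  show "integrable (normal_law \<sigma>) (\<lambda>x. x ^ k)"
    using integrable_normal_moment[OF assms, of 0 k] by (simp add: integrable_density)
  have *: "(\<integral>x. x ^ k \<partial>normal_law \<sigma>) = (\<integral>x. normal_density 0 \<sigma> x * x ^ k \<partial>lborel)" for k
    by (simp add: integral_density)
  show "(\<integral>x. x \<partial>normal_law \<sigma>) = 0" "(\<integral>x. x ^ 3 \<partial>normal_law \<sigma>) = 0"
    using *[of 1] *[of 3] integral_normal_moment_odd[OF assms, of 0 0] integral_normal_moment_odd[OF assms, of 0 1]
    by simp_all
  have "fact (2 * 1) / ((2 / \<sigma>\<^sup>2) ^ 1 * fact 1) = \<sigma>\<^sup>2" "fact (2 * 2) / ((2 / \<sigma>\<^sup>2) ^ 2 * fact 2) = 3 * \<sigma> ^ 4"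
    using assms by (simp_all add: fact_numeral power_divide power2_eq_square power4_eq_xxxx)
  then show "(\<integral>x. x ^ 2 \<partial>normal_law \<sigma>) = \<sigma>\<^sup>2" "(\<integral>x. x ^ 4 \<partial>normal_law \<sigma>) = 3 * \<sigma> ^ 4"
    using *[of 2] *[of 4] integral_normal_moment_even[OF assms, of 0 1] integral_normal_moment_even[OF assms, of 0 2]
    by simp_all
qed

text \<open>No mixed term in \<open>a * c\<close> survives because the first and third moments
  vanish; the centred square has variance \<open>3 * \<sigma> ^ 4 - \<sigma> ^ 4\<close>.\<close>

lemma (in prob_space) normal_quadratic_moments:
  assumes \<sigma>: "\<sigma> > 0" and e [measurable]: "e \<in> borel_measurable M" and law: "distr M borel e = normal_law \<sigma>"
  shows "integrable M (\<lambda>\<omega>. (a * e \<omega> + c * ((e \<omega>)\<^sup>2 - \<sigma>\<^sup>2))\<^sup>2)"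
    and "expectation (\<lambda>\<omega>. a * e \<omega> + c * ((e \<omega>)\<^sup>2 - \<sigma>\<^sup>2)) = 0"
    and "expectation (\<lambda>\<omega>. (a * e \<omega> + c * ((e \<omega>)\<^sup>2 - \<sigma>\<^sup>2))\<^sup>2) = a\<^sup>2 * \<sigma>\<^sup>2 + 2 * c\<^sup>2 * \<sigma> ^ 4"
proof -
  interpret N: prob_space "normal_law \<sigma>" using prob_space_normal_density[OF \<sigma>] .
  note int = normal_law_moments(1)[OF \<sigma>] normal_law_moments(1)[OF \<sigma>, of 1, simplified]
  note val = normal_law_moments(2-)[OF \<sigma>]
  have sq: "(a * x + c * (x\<^sup>2 - \<sigma>\<^sup>2))\<^sup>2 =
    c\<^sup>2 * x ^ 4 + 2 * a * c * x ^ 3 + (a\<^sup>2 - 2 * c\<^sup>2 * \<sigma>\<^sup>2) * x ^ 2 - 2 * a * c * \<sigma>\<^sup>2 * x + c\<^sup>2 * \<sigma> ^ 4" for x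
    by (simp add: power2_eq_square power3_eq_cube power4_eq_xxxx algebra_simps)
  have "integrable (normal_law \<sigma>) (\<lambda>x. (a * x + c * (x\<^sup>2 - \<sigma>\<^sup>2))\<^sup>2)"
    unfolding sq using int by simp
  then show "integrable M (\<lambda>\<omega>. (a * e \<omega> + c * ((e \<omega>)\<^sup>2 - \<sigma>\<^sup>2))\<^sup>2)"
    unfolding law[symmetric] by (subst (asm) integrable_distr_eq) auto
  have "expectation (\<lambda>\<omega>. a * e \<omega> + c * ((e \<omega>)\<^sup>2 - \<sigma>\<^sup>2)) = (\<integral>x. a * x + c * (x\<^sup>2 - \<sigma>\<^sup>2) \<partial>normal_law \<sigma>)"
    unfolding law[symmetric] by (subst integral_distr) auto
  also have "\<dots> = 0" using int val N.prob_space by simp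
  finally show "expectation (\<lambda>\<omega>. a * e \<omega> + c * ((e \<omega>)\<^sup>2 - \<sigma>\<^sup>2)) = 0" .
  have "expectation (\<lambda>\<omega>. (a * e \<omega> + c * ((e \<omega>)\<^sup>2 - \<sigma>\<^sup>2))\<^sup>2) = (\<integral>x. (a * x + c * (x\<^sup>2 - \<sigma>\<^sup>2))\<^sup>2 \<partial>normal_law \<sigma>)"
    unfolding law[symmetric] by (subst integral_distr) auto
  also have "\<dots> = c\<^sup>2 * (3 * \<sigma> ^ 4) + (a\<^sup>2 - 2 * c\<^sup>2 * \<sigma>\<^sup>2) * \<sigma>\<^sup>2 + c\<^sup>2 * \<sigma> ^ 4"
    unfolding sq using int val N.prob_space by simp
  also have "\<dots> = a\<^sup>2 * \<sigma>\<^sup>2 + 2 * c\<^sup>2 * \<sigma> ^ 4"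
    by (simp add: power2_eq_square power4_eq_xxxx algebra_simps)
  finally show "expectation (\<lambda>\<omega>. (a * e \<omega> + c * ((e \<omega>)\<^sup>2 - \<sigma>\<^sup>2))\<^sup>2) = a\<^sup>2 * \<sigma>\<^sup>2 + 2 * c\<^sup>2 * \<sigma> ^ 4" .
qed

text \<open>The filter is chosen after the sample point, which makes the bound uniform in \<alpha>.
  The threshold is halved between two maximal inequalities, whence a factor 4: the linear parts give
  \<open>32 = 2 * 4 * 4\<close>, the quadratic parts
  \<open>40 = 4 * (2 * 1 + 2 * 4)\<close>.\<close>

lemma (in prob_space) monotone_filter_tail:
  fixes e :: "nat \<Rightarrow> 'a \<Rightarrow> real"
  assumes \<sigma>: "\<sigma> > 0" and indep: "indep_vars (\<lambda>_. borel) e {..<n}"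
    and law: "\<And>i. i < n \<Longrightarrow> distr M borel (e i) = normal_law \<sigma>"
    and t: "t > 0"
    and E: "\<And>\<omega>. \<omega> \<in> E \<Longrightarrow> \<omega> \<in> space M \<and> (\<exists>f. (\<forall>i j. i \<le> j \<longrightarrow> j < n \<longrightarrow> f j \<le> f i) \<and> (\<forall>i<n. 0 \<le> f i \<and> f i \<le> 1) \<and>
       t < \<bar>\<Sum>i<n. 2 * (1 - f i) * b i * e i \<omega> + (1 - 2 * f i) * ((e i \<omega>)\<^sup>2 - \<sigma>\<^sup>2)\<bar>)"
  shows "prob E \<le> (32 * \<sigma>\<^sup>2 * (\<Sum>i<n. (b i)\<^sup>2) + 40 * real n * \<sigma> ^ 4) / t\<^sup>2"
proof -
  have e [measurable]: "e i \<in> borel_measurable M" if "i < n" for i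
    using indep that by (auto simp: indep_vars_def)
  \<comment> \<open>The statistic is affine in the filter: it is the sum of \<open>X 1 i\<close>
    minus the sum of \<open>f i * X 2 i\<close>. Both families share the linear coefficient
    \<open>2 * b i\<close>.\<close>
  define X where "X c i \<omega> = 2 * b i * e i \<omega> + c * ((e i \<omega>)\<^sup>2 - \<sigma>\<^sup>2)" for c i \<omega>
  define F where "F c = {\<omega> \<in> space M. \<exists>k\<le>n. t / 2 < \<bar>\<Sum>i<k. X c i \<omega>\<bar>}" for c
  have Xm [measurable]: "X c i \<in> borel_measurable M" if "i < n" for c i
    unfolding X_def using that by simp
  have F: "F c \<in> sets M" for c
  proof -
    have "(\<lambda>\<omega>. \<Sum>i<k. X c i \<omega>) \<in> borel_measurable M" if "k \<le> n" for k
      using that by (intro borel_measurable_sum Xm) auto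
    then have "{\<omega> \<in> space M. t / 2 < \<bar>\<Sum>i<k. X c i \<omega>\<bar>} \<in> sets M" if "k \<le> n" for k
      using that by (intro borel_measurable_less borel_measurable_abs borel_measurable_const) auto
    then have "(\<Union>k\<le>n. {\<omega> \<in> space M. t / 2 < \<bar>\<Sum>i<k. X c i \<omega>\<bar>}) \<in> sets M" by auto
    also have "(\<Union>k\<le>n. {\<omega> \<in> space M. t / 2 < \<bar>\<Sum>i<k. X c i \<omega>\<bar>}) = F c" by (auto simp: F_def)
    finally show ?thesis .
  qed
  have PF: "prob (F c) \<le> (\<Sum>i<n. (2 * b i)\<^sup>2 * \<sigma>\<^sup>2 + 2 * c\<^sup>2 * \<sigma> ^ 4) / (t / 2)\<^sup>2" for c
  proof -
    have "indep_vars (\<lambda>_. borel) (X c) {..<n}"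
      using indep_vars_compose2[OF indep, of "\<lambda>i x. 2 * b i * x + c * (x\<^sup>2 - \<sigma>\<^sup>2)" "\<lambda>_. borel"]
      by (simp add: X_def[abs_def])
    then have "prob (F c) \<le> (\<Sum>i<n. expectation (\<lambda>\<omega>. (X c i \<omega>)\<^sup>2)) / (t / 2)\<^sup>2"
      unfolding F_def
    proof (rule kolmogorov_maximal_inequality)
      show "integrable M (\<lambda>\<omega>. (X c i \<omega>)\<^sup>2)" "expectation (X c i) = 0" if "i < n" for i
        unfolding X_def using normal_quadratic_moments(1,2)[OF \<sigma> e[OF that] law[OF that]] by auto
    qed (use t in simp)
    also have "(\<Sum>i<n. expectation (\<lambda>\<omega>. (X c i \<omega>)\<^sup>2)) = (\<Sum>i<n. (2 * b i)\<^sup>2 * \<sigma>\<^sup>2 + 2 * c\<^sup>2 * \<sigma> ^ 4)"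
      unfolding X_def using normal_quadratic_moments(3)[OF \<sigma> e law] by (intro sum.cong) auto
    finally show ?thesis .
  qed
  have "E \<subseteq> F 1 \<union> F 2"
  proof
    fix \<omega> assume "\<omega> \<in> E"
    then have \<omega>: "\<omega> \<in> space M" using E by simp
    from E[OF \<open>\<omega> \<in> E\<close>] obtain f
      where f': "\<forall>i j. i \<le> j \<longrightarrow> j < n \<longrightarrow> f j \<le> f i" "\<forall>i<n. 0 \<le> f i \<and> f i \<le> 1"
      and big: "t < \<bar>\<Sum>i<n. 2 * (1 - f i) * b i * e i \<omega> + (1 - 2 * f i) * ((e i \<omega>)\<^sup>2 - \<sigma>\<^sup>2)\<bar>"
      by (elim conjE exE)
    then have f: "\<And>i j. i \<le> j \<Longrightarrow> j < n \<Longrightarrow> f j \<le> f i" "\<And>i. i < n \<Longrightarrow> 0 \<le> f i" "\<And>i. i < n \<Longrightarrow> f i \<le> 1"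
      by auto
    have "(\<Sum>i<n. 2 * (1 - f i) * b i * e i \<omega> + (1 - 2 * f i) * ((e i \<omega>)\<^sup>2 - \<sigma>\<^sup>2)) = (\<Sum>i<n. X 1 i \<omega>) - (\<Sum>i<n. f i * X 2 i \<omega>)"
      unfolding sum_subtractf[symmetric] by (intro sum.cong) (auto simp: X_def algebra_simps)
    then have "t / 2 < \<bar>\<Sum>i<n. X 1 i \<omega>\<bar> \<or> t / 2 < \<bar>\<Sum>i<n. f i * X 2 i \<omega>\<bar>" using big by auto
    then show "\<omega> \<in> F 1 \<union> F 2"
    proof
      assume "t / 2 < \<bar>\<Sum>i<n. X 1 i \<omega>\<bar>"
      then show ?thesis using \<omega> by (auto simp: F_def)
    next
      assume "t / 2 < \<bar>\<Sum>i<n. f i * X 2 i \<omega>\<bar>"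
      moreover have "\<bar>\<Sum>i<n. f i * X 2 i \<omega>\<bar> \<le> t / 2" if "\<And>k. k \<le> n \<Longrightarrow> \<bar>\<Sum>i<k. X 2 i \<omega>\<bar> \<le> t / 2"
        by (rule abs_sum_antimono_mult_le[OF f that])
      ultimately have "\<exists>k\<le>n. t / 2 < \<bar>\<Sum>i<k. X 2 i \<omega>\<bar>" by (meson not_le)
      then show ?thesis using \<omega> by (auto simp: F_def)
    qed
  qed
  \<comment> \<open>Monotonicity asks for measurability of the covering set, hence the earlier fact
    \<open>F\<close>.\<close>
  then have "prob E \<le> prob (F 1 \<union> F 2)" using F by (intro finite_measure_mono) auto
  also have "\<dots> \<le> prob (F 1) + prob (F 2)" using F by (intro measure_Un_le) auto
  also have "\<dots> \<le> (\<Sum>i<n. (2 * b i)\<^sup>2 * \<sigma>\<^sup>2 + 2 * 1\<^sup>2 * \<sigma> ^ 4) / (t / 2)\<^sup>2 + (\<Sum>i<n. (2 * b i)\<^sup>2 * \<sigma>\<^sup>2 + 2 * 2\<^sup>2 * \<sigma> ^ 4) / (t / 2)\<^sup>2"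
    by (intro add_mono PF)
  also have "\<dots> = (32 * \<sigma>\<^sup>2 * (\<Sum>i<n. (b i)\<^sup>2) + 40 * real n * \<sigma> ^ 4) / t\<^sup>2"
  proof -
    have "(\<Sum>i<n. (2 * b i)\<^sup>2 * \<sigma>\<^sup>2 + k * \<sigma> ^ 4) = 4 * \<sigma>\<^sup>2 * (\<Sum>i<n. (b i)\<^sup>2) + real n * (k * \<sigma> ^ 4)" for k
      by (simp add: sum.distrib sum_distrib_left power_mult_distrib mult.commute mult.left_commute)
    then show ?thesis using t by (simp add: power_divide add_divide_distrib[symmetric])
  qed
  finally show ?thesis .
qed

subsection \<open>The Tikhonov estimator in singular coordinates\<close>

lemma index_mult_diag_mult_transpose:
  fixes U V :: "real mat"
  assumes "V \<in> carrier_mat n n" "U \<in> carrier_mat n n" "i < n" "j < n"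
  shows "(V * mat_diag n d * transpose_mat U) $$ (i, j) = (\<Sum>k<n. V $$ (i, k) * d k * U $$ (j, k))"
  using assms by (simp add: mat_diag_mult_right[OF assms(1)] scalar_prod_def atLeast0LessThan)

lemma orthogonal_mult_transpose:
  fixes U :: "real mat"
  assumes "U \<in> carrier_mat n n" "transpose_mat U * U = 1\<^sub>m n"
  shows "U * transpose_mat U = 1\<^sub>m n"
  using assms by (intro mat_mult_left_right_inverse[of "transpose_mat U"]) auto

lemma diag_conjugate_mult:
  fixes U V W :: "real mat"
  assumes [simp]: "U \<in> carrier_mat n n" "V \<in> carrier_mat n n" "W \<in> carrier_mat n n"
    and V: "transpose_mat V * V = 1\<^sub>m n"
  shows "(U * mat_diag n f * transpose_mat V) * (V * mat_diag n g * transpose_mat W) =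
    U * mat_diag n (\<lambda>i. f i * g i) * transpose_mat W"
proof -
  note [simp] = assoc_mult_mat[of _ n n _ n _ n] mult_carrier_mat[of _ n n _ n]
  have "transpose_mat V * (V * X) = X" if "X \<in> carrier_mat n n" for X
    using that assoc_mult_mat[of "transpose_mat V" n n V n X n] V by simp
  moreover have "mat_diag n f * (mat_diag n g * X) = mat_diag n (\<lambda>i. f i * g i) * X"
    if "X \<in> carrier_mat n n" for X
    using that assoc_mult_mat[of "mat_diag n f" n n "mat_diag n g" n X n] by simp
  ultimately show ?thesis by simp
qed

lemma transpose_diag_conjugate:
  fixes U V :: "real mat"
  assumes "U \<in> carrier_mat n n" "V \<in> carrier_mat n n"
  shows "transpose_mat (U * mat_diag n f * transpose_mat V) = V * mat_diag n f * transpose_mat U"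
proof (rule eq_matI)
  fix i j assume "i < dim_row (V * mat_diag n f * transpose_mat U)" "j < dim_col (V * mat_diag n f * transpose_mat U)"
  then have ij: "i < n" "j < n" using assms by auto
  have "transpose_mat (U * mat_diag n f * transpose_mat V) $$ (i, j) = (U * mat_diag n f * transpose_mat V) $$ (j, i)"
    using assms ij by (intro index_transpose_mat) auto
  then show "transpose_mat (U * mat_diag n f * transpose_mat V) $$ (i, j) = (V * mat_diag n f * transpose_mat U) $$ (i, j)"
    using index_mult_diag_mult_transpose[OF assms ij(2,1)] index_mult_diag_mult_transpose[OF assms(2,1) ij]
    by (simp add: mult.commute mult.left_commute)
qed (use assms in auto)

text \<open>The result \<open>None\<close> is excluded because \<open>P\<close> is a unit of the
  matrix ring; the matrix returned then equals \<open>B\<close> by uniqueness of inverses.\<close>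

lemma mat_inverse_eqI:
  fixes P :: "'a :: field mat"
  assumes P: "P \<in> carrier_mat n n" and B: "B \<in> carrier_mat n n" and BP: "B * P = 1\<^sub>m n"
  shows "mat_inverse P = Some B"
proof -
  have PB: "P * B = 1\<^sub>m n" by (rule mat_mult_left_right_inverse[OF B P BP])
  have "P \<in> Units (ring_mat TYPE('a) n undefined)"
    using P B BP PB by (auto simp: Units_def ring_mat_def)
  then obtain C where C: "mat_inverse P = Some C"
    using mat_inverse(1)[OF P, of undefined] by (cases "mat_inverse P") auto
  have C': "C * P = 1\<^sub>m n" "C \<in> carrier_mat n n" using mat_inverse(2)[OF P C] by auto
  have "C = C * (P * B)" using C' PB by simp
  also have "\<dots> = (C * P) * B" by (rule assoc_mult_mat[OF C'(2) P B, symmetric])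
  also have "\<dots> = B" using C'(1) B by simp
  finally show ?thesis using C C' B by simp
qed

lemma tikhonov_mat_svd_pos:
  fixes U V :: "real mat"
  assumes U: "U \<in> carrier_mat n n" "transpose_mat U * U = 1\<^sub>m n"
    and V: "V \<in> carrier_mat n n" "transpose_mat V * V = 1\<^sub>m n"
    and A: "A = U * mat_diag n \<gamma> * transpose_mat V" and \<alpha>: "\<alpha> > 0"
  shows "the (mat_inverse (transpose_mat A * A + \<alpha> \<cdot>\<^sub>m 1\<^sub>m (dim_col A))) * transpose_mat A =
    V * mat_diag n (\<lambda>i. \<gamma> i / ((\<gamma> i)\<^sup>2 + \<alpha>)) * transpose_mat U"
proof -
  let ?P = "V * mat_diag n (\<lambda>i. (\<gamma> i)\<^sup>2 + \<alpha>) * transpose_mat V"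
  let ?B = "V * mat_diag n (\<lambda>i. 1 / ((\<gamma> i)\<^sup>2 + \<alpha>)) * transpose_mat V"
  have At: "transpose_mat A = V * mat_diag n \<gamma> * transpose_mat U"
    unfolding A using U V by (intro transpose_diag_conjugate)
  have VV: "V * transpose_mat V = 1\<^sub>m n" using V by (rule orthogonal_mult_transpose)
  have AtA: "transpose_mat A * A = V * mat_diag n (\<lambda>i. \<gamma> i * \<gamma> i) * transpose_mat V"
    unfolding At unfolding A using U V by (intro diag_conjugate_mult) auto
  \<comment> \<open>With the identity also written as a conjugated diagonal matrix, the regularising
    term just shifts the diagonal by \<alpha>.\<close>
  have one: "1\<^sub>m n = V * mat_diag n (\<lambda>_. 1) * transpose_mat V" using V VV by simp
  have "transpose_mat A * A + \<alpha> \<cdot>\<^sub>m 1\<^sub>m (dim_col A) = ?P"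
  proof (rule eq_matI)
    fix i j assume "i < dim_row ?P" "j < dim_col ?P"
    then have ij: "i < n" "j < n" using V by auto
    have "(transpose_mat A * A + \<alpha> \<cdot>\<^sub>m 1\<^sub>m (dim_col A)) $$ (i, j) =
      (V * mat_diag n (\<lambda>i. \<gamma> i * \<gamma> i) * transpose_mat V) $$ (i, j) + \<alpha> * (V * mat_diag n (\<lambda>_. 1) * transpose_mat V) $$ (i, j)"
      unfolding AtA one[symmetric] using ij A V by simp
    also have "\<dots> = ?P $$ (i, j)"
      unfolding index_mult_diag_mult_transpose[OF V(1) V(1) ij]
      by (simp add: sum_distrib_left sum.distrib[symmetric] algebra_simps power2_eq_square)
    finally show "(transpose_mat A * A + \<alpha> \<cdot>\<^sub>m 1\<^sub>m (dim_col A)) $$ (i, j) = ?P $$ (i, j)" .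
  qed (use A U V in auto)
  moreover have "mat_inverse ?P = Some ?B"
  proof (rule mat_inverse_eqI)
    have "(\<gamma> i)\<^sup>2 + \<alpha> \<noteq> 0" for i using \<alpha> by (metis add_nonneg_pos less_irrefl zero_le_power2)
    then have "(\<lambda>i. 1 / ((\<gamma> i)\<^sup>2 + \<alpha>) * ((\<gamma> i)\<^sup>2 + \<alpha>)) = (\<lambda>_. 1)" by simp
    then show "?B * ?P = 1\<^sub>m n"
      unfolding diag_conjugate_mult[OF V(1) V(1) V(1) V(2)] one by (simp only:)
  qed (use V in \<open>auto intro!: mult_carrier_mat\<close>)
  ultimately show ?thesis
    using diag_conjugate_mult[OF V(1) V(1) U(1) V(2), of "\<lambda>i. 1 / ((\<gamma> i)\<^sup>2 + \<alpha>)" \<gamma>] At by simp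
qed

text \<open>At \<open>\<alpha> = 0\<close> this is the pseudoinverse, because \<open>0 / 0 = 0\<close>.\<close>

lemma tikhonov_mat_svd:
  fixes U V :: "real mat"
  assumes U: "U \<in> carrier_mat n n" "transpose_mat U * U = 1\<^sub>m n"
    and V: "V \<in> carrier_mat n n" "transpose_mat V * V = 1\<^sub>m n"
    and A: "A = U * mat_diag n \<gamma> * transpose_mat V" and \<alpha>: "\<alpha> \<ge> 0"
  shows "tikhonov_mat A \<alpha> = V * mat_diag n (\<lambda>i. \<gamma> i / ((\<gamma> i)\<^sup>2 + \<alpha>)) * transpose_mat U"
proof (cases "\<alpha> = 0")
  case False
  then show ?thesis using \<alpha> tikhonov_mat_svd_pos[OF U V A, of \<alpha>] by (simp add: tikhonov_mat_def Let_def)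
next
  case True
  let ?R = "\<lambda>\<beta>. the (mat_inverse (transpose_mat A * A + \<beta> \<cdot>\<^sub>m 1\<^sub>m (dim_col A))) * transpose_mat A"
  have dim: "dim_col A = n" "dim_row A = n" using A U V by auto
  have "Lim (at_right 0) (\<lambda>\<beta>. ?R \<beta> $$ (i, j)) = (V * mat_diag n (\<lambda>i. \<gamma> i / (\<gamma> i)\<^sup>2) * transpose_mat U) $$ (i, j)"
    if ij: "i < n" "j < n" for i j
  proof (rule tendsto_Lim)
    \<comment> \<open>For \<open>\<gamma> k = 0\<close> the function and its claimed limit are both
      0; otherwise the denominator stays away from 0 and the quotient is continuous.\<close>
    have lim: "((\<lambda>\<beta>. \<gamma> k / ((\<gamma> k)\<^sup>2 + \<beta>)) \<longlongrightarrow> \<gamma> k / (\<gamma> k)\<^sup>2) (at_right 0)" for k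
    proof (cases "\<gamma> k = 0")
      case False
      then have "((\<lambda>\<beta>. \<gamma> k / ((\<gamma> k)\<^sup>2 + \<beta>)) \<longlongrightarrow> \<gamma> k / ((\<gamma> k)\<^sup>2 + 0)) (at_right 0)"
        by (intro tendsto_intros) auto
      then show ?thesis by simp
    qed simp
    have "((\<lambda>\<beta>. (V * mat_diag n (\<lambda>i. \<gamma> i / ((\<gamma> i)\<^sup>2 + \<beta>)) * transpose_mat U) $$ (i, j)) \<longlongrightarrow>
       (V * mat_diag n (\<lambda>i. \<gamma> i / (\<gamma> i)\<^sup>2) * transpose_mat U) $$ (i, j)) (at_right 0)"
      unfolding index_mult_diag_mult_transpose[OF V(1) U(1) ij] by (intro tendsto_intros lim)
    moreover have "\<forall>\<^sub>F \<beta> in at_right 0. (V * mat_diag n (\<lambda>i. \<gamma> i / ((\<gamma> i)\<^sup>2 + \<beta>)) * transpose_mat U) $$ (i, j) = ?R \<beta> $$ (i, j)"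
      using tikhonov_mat_svd_pos[OF U V A] by (auto simp: eventually_at_filter)
    ultimately show "((\<lambda>\<beta>. ?R \<beta> $$ (i, j)) \<longlongrightarrow> (V * mat_diag n (\<lambda>i. \<gamma> i / (\<gamma> i)\<^sup>2) * transpose_mat U) $$ (i, j)) (at_right 0)"
      by (rule Lim_transform_eventually)
  qed simp
  then show ?thesis using True U V by (intro eq_matI) (auto simp: tikhonov_mat_def dim)
qed

lemma sq_norm2_orthogonal:
  fixes U :: "real mat"
  assumes U: "U \<in> carrier_mat n n" "transpose_mat U * U = 1\<^sub>m n" and w: "w \<in> carrier_vec n"
  shows "sq_norm2 (U *\<^sub>v w) = sq_norm2 w"
proof -
  have "(U *\<^sub>v w) \<bullet> (U *\<^sub>v w) = (transpose_mat U *\<^sub>v (U *\<^sub>v w)) \<bullet> w"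
    using U w by (intro transpose_vec_mult_scalar[symmetric]) auto
  also have "transpose_mat U *\<^sub>v (U *\<^sub>v w) = w"
    using U w by (subst assoc_mult_mat_vec[symmetric, of _ n n _ n]) auto
  finally show ?thesis by (simp add: sq_norm2_def)
qed

lemma sq_norm2_vec: "sq_norm2 (vec n f) = (\<Sum>i<n. (f i)\<^sup>2)"
  by (simp add: sq_norm2_def scalar_prod_def power2_eq_square atLeast0LessThan)

lemma trace_mat_diag_conjugate:
  fixes U :: "real mat"
  assumes U: "U \<in> carrier_mat n n" "transpose_mat U * U = 1\<^sub>m n"
  shows "trace_mat (U * mat_diag n f * transpose_mat U) = (\<Sum>i<n. f i)"
proof -
  have col: "(\<Sum>i<n. U $$ (i, k) * U $$ (i, k)) = 1" if "k < n" for k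
  proof -
    have "(transpose_mat U * U) $$ (k, k) = (\<Sum>i<n. U $$ (i, k) * U $$ (i, k))"
      using U(1) that by (simp add: scalar_prod_def atLeast0LessThan)
    then show ?thesis using U(2) that by simp
  qed
  have "trace_mat (U * mat_diag n f * transpose_mat U) = (\<Sum>i<n. \<Sum>k<n. U $$ (i, k) * f k * U $$ (i, k))"
  proof -
    have "dim_row (U * mat_diag n f * transpose_mat U) = n" using U by simp
    then show ?thesis
      unfolding trace_mat_def
      by (simp only:) (rule sum.cong[OF refl], rule index_mult_diag_mult_transpose[OF U(1) U(1)], auto)
  qed
  also have "\<dots> = (\<Sum>k<n. f k * (\<Sum>i<n. U $$ (i, k) * U $$ (i, k)))"
    by (subst sum.swap) (simp add: sum_distrib_left mult_ac)
  also have "\<dots> = (\<Sum>k<n. f k)" using col by simp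
  finally show ?thesis .
qed

lemma diag_conjugate_mult_vec:
  fixes U :: "real mat"
  assumes U: "U \<in> carrier_mat n n" "transpose_mat U * U = 1\<^sub>m n" and W: "W \<in> carrier_mat n n"
  shows "(W * mat_diag n f * transpose_mat U) *\<^sub>v (U *\<^sub>v vec n z) = W *\<^sub>v vec n (\<lambda>i. f i * z i)"
proof -
  have "(W * mat_diag n f * transpose_mat U) *\<^sub>v (U *\<^sub>v vec n z) = W * mat_diag n f *\<^sub>v (transpose_mat U *\<^sub>v (U *\<^sub>v vec n z))"
    using U W by (intro assoc_mult_mat_vec[of _ n n _ n]) auto
  also have "transpose_mat U *\<^sub>v (U *\<^sub>v vec n z) = vec n z"
    using U by (subst assoc_mult_mat_vec[symmetric, of _ n n _ n]) auto
  also have "W * mat_diag n f *\<^sub>v vec n z = W *\<^sub>v (mat_diag n f *\<^sub>v vec n z)"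
    using W by (intro assoc_mult_mat_vec[of _ n n _ n]) auto
  also have "mat_diag n f *\<^sub>v vec n z = vec n (\<lambda>i. f i * z i)"
  proof (rule eq_vecI)
    fix i assume "i < dim_vec (vec n (\<lambda>i. f i * z i))"
    then have i: "i < n" by simp
    have "(mat_diag n f *\<^sub>v vec n z) $ i = (\<Sum>j<n. (if i = j then f j else 0) * z j)"
      using i by (simp add: mat_diag_def scalar_prod_def atLeast0LessThan)
    also have "\<dots> = (\<Sum>j<n. if i = j then f j * z j else 0)" by (rule sum.cong) auto
    finally show "(mat_diag n f *\<^sub>v vec n z) $ i = vec n (\<lambda>i. f i * z i) $ i" using i by simp
  qed (simp add: mat_diag_def)
  finally show ?thesis .
qed

text \<open>With \<open>z = b + e\<close> the difference of squares
  \<open>(z - f * z)^2 - (b - f * z)^2\<close> factors as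
  \<open>e * (2 * b + e - 2 * f * z)\<close>, so \<open>f^2\<close> cancels and the result is affine
  in \<open>f\<close>. The variance and trace terms of the risk estimate contribute exactly the
  centring \<open>- (1 - 2 * f) * \<sigma>^2\<close>.\<close>

lemma PSURE_minus_pred_loss_svd:
  fixes U V :: "real mat"
  assumes U: "U \<in> carrier_mat n n" "transpose_mat U * U = 1\<^sub>m n"
    and V: "V \<in> carrier_mat n n" "transpose_mat V * V = 1\<^sub>m n"
    and A: "A = U * mat_diag n \<gamma> * transpose_mat V" and \<alpha>: "\<alpha> \<ge> 0" and n: "n > 0"
    and b: "A *\<^sub>v x = U *\<^sub>v vec n b" and y: "y = U *\<^sub>v vec n (\<lambda>i. b i + e i)"
  defines "f \<equiv> \<lambda>i. (\<gamma> i)\<^sup>2 / ((\<gamma> i)\<^sup>2 + \<alpha>)"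
  shows "PSURE A \<sigma> \<alpha> y / real n - pred_loss A x \<alpha> y =
    (\<Sum>i<n. 2 * (1 - f i) * b i * e i + (1 - 2 * f i) * ((e i)\<^sup>2 - \<sigma>\<^sup>2)) / real n"
proof -
  let ?z = "\<lambda>i. b i + e i"
  have dim: "dim_row A = n" using A U by simp
  have A': "A \<in> carrier_mat n n" unfolding A using U V by (auto intro!: mult_carrier_mat)
  have T: "tikhonov_mat A \<alpha> = V * mat_diag n (\<lambda>i. \<gamma> i / ((\<gamma> i)\<^sup>2 + \<alpha>)) * transpose_mat U"
    by (rule tikhonov_mat_svd[OF U V A \<alpha>])
  have T': "tikhonov_mat A \<alpha> \<in> carrier_mat n n" unfolding T using U V by (auto intro!: mult_carrier_mat)
  have AT: "A * tikhonov_mat A \<alpha> = U * mat_diag n f * transpose_mat U"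
    unfolding T f_def unfolding A using diag_conjugate_mult[OF U(1) V(1) U(1) V(2)] by (simp add: power2_eq_square)
  have Uc: "U *\<^sub>v vec n g \<in> carrier_vec n" for g using U by auto
  have "A *\<^sub>v tikhonov A \<alpha> y = (A * tikhonov_mat A \<alpha>) *\<^sub>v y"
    unfolding tikhonov_def using A' T' y Uc by (intro assoc_mult_mat_vec[symmetric]) auto
  also have "\<dots> = U *\<^sub>v vec n (\<lambda>i. f i * ?z i)"
    unfolding AT y by (rule diag_conjugate_mult_vec[OF U U(1)])
  finally have fit: "A *\<^sub>v tikhonov A \<alpha> y = U *\<^sub>v vec n (\<lambda>i. f i * ?z i)" .
  have diff: "U *\<^sub>v vec n g - U *\<^sub>v vec n h = U *\<^sub>v vec n (\<lambda>i. g i - h i)" for g h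
  proof -
    have "U *\<^sub>v vec n g - U *\<^sub>v vec n h = U *\<^sub>v (vec n g - vec n h)"
      using U by (intro mult_minus_distrib_mat_vec[symmetric]) auto
    also have "vec n g - vec n h = vec n (\<lambda>i. g i - h i)" by auto
    finally show ?thesis .
  qed
  have "PSURE A \<sigma> \<alpha> y = (\<Sum>i<n. (?z i - f i * ?z i)\<^sup>2) - real n * \<sigma>\<^sup>2 + 2 * \<sigma>\<^sup>2 * (\<Sum>i<n. f i)"
    unfolding PSURE_def fit AT trace_mat_diag_conjugate[OF U] dim unfolding y diff
    by (simp add: sq_norm2_orthogonal[OF U] sq_norm2_vec)
  moreover have "pred_loss A x \<alpha> y = (\<Sum>i<n. (b i - f i * ?z i)\<^sup>2) / real n"
    unfolding pred_loss_def fit b dim diff by (simp add: sq_norm2_orthogonal[OF U] sq_norm2_vec)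
  moreover have "(\<Sum>i<n. (?z i - f i * ?z i)\<^sup>2) - real n * \<sigma>\<^sup>2 + 2 * \<sigma>\<^sup>2 * (\<Sum>i<n. f i) - (\<Sum>i<n. (b i - f i * ?z i)\<^sup>2) =
     (\<Sum>i<n. (?z i - f i * ?z i)\<^sup>2 - \<sigma>\<^sup>2 + 2 * \<sigma>\<^sup>2 * f i - (b i - f i * ?z i)\<^sup>2)"
    by (simp add: sum.distrib sum_subtractf sum_distrib_left)
  moreover have "\<dots> = (\<Sum>i<n. 2 * (1 - f i) * b i * e i + (1 - 2 * f i) * ((e i)\<^sup>2 - \<sigma>\<^sup>2))"
    by (intro sum.cong) (auto simp: power2_eq_square algebra_simps)
  ultimately show ?thesis by (simp add: diff_divide_distrib[symmetric])
qed

section \<open>Law of the noise and of the deviation in singular coordinates\<close>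

text \<open>The noise coordinates are formed with the transpose of \<open>U\<close>, whose columns
  are the rows of \<open>U\<close>. These are orthonormal because a left inverse of a square matrix
  is a right inverse.\<close>

lemma orthonormal_columns_transpose:
  fixes U :: "real mat"
  assumes U: "U \<in> carrier_mat n n" "transpose_mat U * U = 1\<^sub>m n"
  shows "orthonormal_columns n (\<lambda>i j. U $$ (j, i))"
  unfolding orthonormal_columns_def
proof (intro allI impI)
  fix j l assume "j < n" "l < n"
  then have "(U * transpose_mat U) $$ (j, l) = (\<Sum>i<n. U $$ (j, i) * U $$ (l, i))"
    using U(1) by (simp add: scalar_prod_def atLeast0LessThan)
  then show "(\<Sum>i<n. U $$ (j, i) * U $$ (l, i)) = (if j = l then 1 else 0)"
    using orthogonal_mult_transpose[OF U] \<open>j < n\<close> \<open>l < n\<close> by simp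
qed

lemma orthogonal_coordinates:
  fixes U :: "real mat"
  assumes U: "U \<in> carrier_mat n n" "transpose_mat U * U = 1\<^sub>m n" and w: "w \<in> carrier_vec n"
  shows "U *\<^sub>v vec n (\<lambda>i. \<Sum>j<n. U $$ (j, i) * w $ j) = w"
proof -
  have "vec n (\<lambda>i. \<Sum>j<n. U $$ (j, i) * w $ j) = transpose_mat U *\<^sub>v w"
    using U w by (intro eq_vecI) (auto simp: scalar_prod_def atLeast0LessThan)
  moreover have "U *\<^sub>v (transpose_mat U *\<^sub>v w) = w"
    using U w orthogonal_mult_transpose[OF U] by (subst assoc_mult_mat_vec[symmetric, of _ n n _ n]) auto
  ultimately show ?thesis by simp
qed

text \<open>The joint law of the rotated coordinates is the image of
  \<open>iid_normal n \<sigma>\<close> under an orthogonal map, hence the same product; marginals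
  and independence are both read off from it.\<close>

lemma (in prob_space) gaussian_noise_orthogonal:
  assumes \<sigma>: "\<sigma> > 0" and n: "n > 0" and noise: "gaussian_noise M n \<sigma> \<epsilon>"
    and q: "orthonormal_columns n q"
  defines "e \<equiv> \<lambda>i \<omega>. \<Sum>j<n. q i j * \<epsilon> \<omega> $ j"
  shows "indep_vars (\<lambda>_. borel) e {..<n}" and "\<And>i. i < n \<Longrightarrow> distr M borel (e i) = normal_law \<sigma>"
proof -
  interpret N: prob_space "normal_law \<sigma>" using prob_space_normal_density[OF \<sigma>] .
  let ?B = "\<Pi>\<^sub>M i\<in>{..<n}. (borel :: real measure)"
  have \<epsilon> [measurable]: "(\<lambda>\<omega>. \<epsilon> \<omega> $ i) \<in> borel_measurable M" if "i < n" for i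
    using noise that by (auto simp: gaussian_noise_def)
  have em [measurable]: "e i \<in> borel_measurable M" for i
    unfolding e_def by (intro borel_measurable_sum borel_measurable_times \<epsilon>) auto
  have sets: "sets (iid_normal n \<sigma>) = sets ?B" by (intro sets_PiM_cong) auto
  have "linear_image n q (\<lambda>i\<in>{..<n}. \<epsilon> \<omega> $ i) = (\<lambda>i\<in>{..<n}. e i \<omega>)" for \<omega>
    by (auto simp: linear_image_def e_def fun_eq_iff)
  then have "distr M ?B (\<lambda>\<omega>. \<lambda>i\<in>{..<n}. e i \<omega>) = distr (distr M ?B (\<lambda>\<omega>. \<lambda>i\<in>{..<n}. \<epsilon> \<omega> $ i)) ?B (linear_image n q)"
    using measurable_linear_image[where n=n and q=q and \<sigma>=\<sigma>]
    by (subst distr_distr) (auto simp: comp_def measurable_cong_sets[OF sets sets] intro!: measurable_restrict)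
  also have "distr M ?B (\<lambda>\<omega>. \<lambda>i\<in>{..<n}. \<epsilon> \<omega> $ i) = iid_normal n \<sigma>"
    using noise by (simp add: gaussian_noise_def)
  also have "distr (iid_normal n \<sigma>) ?B (linear_image n q) = distr (iid_normal n \<sigma>) (iid_normal n \<sigma>) (linear_image n q)"
    by (intro distr_cong sets[symmetric]) auto
  also have "\<dots> = iid_normal n \<sigma>" by (rule distr_linear_image[OF \<sigma> q])
  finally have joint: "distr M ?B (\<lambda>\<omega>. \<lambda>i\<in>{..<n}. e i \<omega>) = iid_normal n \<sigma>" .
  show marginal: "distr M borel (e i) = normal_law \<sigma>" if i: "i < n" for i
  proof -
    have "distr M borel (e i) = distr (distr M ?B (\<lambda>\<omega>. \<lambda>i\<in>{..<n}. e i \<omega>)) borel (\<lambda>x. x i)"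
      using i by (subst distr_distr) (auto simp: comp_def intro!: measurable_restrict)
    also have "\<dots> = distr (iid_normal n \<sigma>) (normal_law \<sigma>) (\<lambda>x. x i)"
      unfolding joint by (intro distr_cong) auto
    also have "\<dots> = normal_law \<sigma>"
      using i by (intro distr_PiM_component) (auto intro: N.prob_space_axioms)
    finally show ?thesis .
  qed
  show "indep_vars (\<lambda>_. borel) e {..<n}"
  \<comment> \<open>The criterion asks for a nonempty index set; \<open>n > 0\<close> provides
    it.\<close>
  proof (subst indep_vars_iff_distr_eq_PiM')
    have "(\<Pi>\<^sub>M i\<in>{..<n}. distr M borel (e i)) = iid_normal n \<sigma>"
      using marginal by (intro PiM_cong) auto
    then show "distr M ?B (\<lambda>x. \<lambda>i\<in>{..<n}. e i x) = (\<Pi>\<^sub>M i\<in>{..<n}. distr M borel (e i))"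
      using joint by simp
  qed (use n em in auto)
qed

text \<open>The same \<open>b\<close> and \<open>e\<close> serve every \<alpha>, which enters
  through the filter alone. The bound on \<open>b\<close> comes from
  \<open>b i = \<gamma> i * c i\<close>, where \<open>c\<close> holds the coordinates of
  \<open>x\<close> in the basis \<open>V\<close> and \<open>\<gamma> i \<le> 1\<close>.\<close>

lemma (in prob_space) PSURE_minus_pred_loss_representation:
  assumes \<sigma>: "\<sigma> > 0" and n: "n > 0" and A: "A \<in> carrier_mat n n" and x: "x \<in> carrier_vec n"
    and noise: "gaussian_noise M n \<sigma> \<epsilon>"
    and y: "\<And>\<omega>. \<omega> \<in> space M \<Longrightarrow> y \<omega> = A *\<^sub>v x + \<epsilon> \<omega>"
    and sv: "singular_values A \<gamma>" and \<gamma>: "\<And>i. i < n \<Longrightarrow> 0 \<le> \<gamma> i \<and> \<gamma> i \<le> 1"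
  obtains b e where "(\<Sum>i<n. (b i)\<^sup>2) \<le> sq_norm2 x"
    and "indep_vars (\<lambda>_. borel) e {..<n}" "\<And>i. i < n \<Longrightarrow> distr M borel (e i) = normal_law \<sigma>"
    and "\<And>\<omega> \<alpha>. \<omega> \<in> space M \<Longrightarrow> \<alpha> \<ge> 0 \<Longrightarrow> PSURE A \<sigma> \<alpha> (y \<omega>) / real n - pred_loss A x \<alpha> (y \<omega>) =
      (\<Sum>i<n. 2 * (1 - (\<gamma> i)\<^sup>2 / ((\<gamma> i)\<^sup>2 + \<alpha>)) * b i * e i \<omega> +
        (1 - 2 * ((\<gamma> i)\<^sup>2 / ((\<gamma> i)\<^sup>2 + \<alpha>))) * ((e i \<omega>)\<^sup>2 - \<sigma>\<^sup>2)) / real n"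
proof -
  have dim: "dim_row A = n" using A by simp
  obtain U V where U: "U \<in> carrier_mat n n" "transpose_mat U * U = 1\<^sub>m n"
    and V: "V \<in> carrier_mat n n" "transpose_mat V * V = 1\<^sub>m n" and svd: "A = U * mat_diag n \<gamma> * transpose_mat V"
    using sv by (auto simp: singular_values_def Let_def dim)
  define c where "c i = (\<Sum>j<n. V $$ (j, i) * x $ j)" for i
  define b where "b i = \<gamma> i * c i" for i
  define e where "e i \<omega> = (\<Sum>j<n. U $$ (j, i) * \<epsilon> \<omega> $ j)" for i \<omega>
  have xV: "V *\<^sub>v vec n c = x" unfolding c_def by (rule orthogonal_coordinates[OF V x])
  have Ax: "A *\<^sub>v x = U *\<^sub>v vec n b"
    unfolding svd b_def using diag_conjugate_mult_vec[OF V U(1), of \<gamma> c] xV by simp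
  have "(\<Sum>i<n. (b i)\<^sup>2) \<le> (\<Sum>i<n. (c i)\<^sup>2)"
    unfolding b_def power_mult_distrib using \<gamma> by (intro sum_mono mult_left_le_one_le) (auto simp: power_le_one)
  also have "\<dots> = sq_norm2 x"
    using sq_norm2_orthogonal[OF V, of "vec n c"] xV by (simp add: sq_norm2_vec)
  finally have 1: "(\<Sum>i<n. (b i)\<^sup>2) \<le> sq_norm2 x" .
  note 2 = gaussian_noise_orthogonal[OF \<sigma> n noise orthonormal_columns_transpose[OF U], folded e_def]
  have Uy: "y \<omega> = U *\<^sub>v vec n (\<lambda>i. b i + e i \<omega>)" if \<omega>: "\<omega> \<in> space M" for \<omega>
  proof -
    have "\<epsilon> \<omega> \<in> carrier_vec n" using noise \<omega> by (auto simp: gaussian_noise_def)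
    then have "\<epsilon> \<omega> = U *\<^sub>v vec n (\<lambda>i. e i \<omega>)"
      unfolding e_def by (rule orthogonal_coordinates[OF U, symmetric])
    then have "y \<omega> = U *\<^sub>v vec n b + U *\<^sub>v vec n (\<lambda>i. e i \<omega>)" using y[OF \<omega>] Ax by simp
    also have "\<dots> = U *\<^sub>v (vec n b + vec n (\<lambda>i. e i \<omega>))"
      using U(1) by (intro mult_add_distrib_mat_vec[symmetric]) auto
    also have "vec n b + vec n (\<lambda>i. e i \<omega>) = vec n (\<lambda>i. b i + e i \<omega>)" by auto
    finally show ?thesis .
  qed
  show thesis
    by (rule that[OF 1 2]) (assumption, rule PSURE_minus_pred_loss_svd[OF U V svd _ n Ax Uy])
qed

text \<open>Makes the filter monotone in the singular value. The case \<open>u = 0\<close> includes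
  the quotient \<open>0 / 0 = 0\<close> at \<open>\<alpha> = 0\<close>.\<close>

lemma divide_add_mono:
  fixes u v \<alpha> :: real
  assumes "0 \<le> u" "u \<le> v" "0 \<le> \<alpha>"
  shows "u / (u + \<alpha>) \<le> v / (v + \<alpha>)"
proof (cases "u = 0")
  case False
  then have "u > 0" "v > 0" using assms by auto
  then show ?thesis using assms by (simp add: divide_simps) (simp add: algebra_simps mult_left_mono)
qed (use assms in auto)

section \<open>Measurability and tail of the supremum in a fixed dimension\<close>

context prob_space
begin

context
  fixes \<sigma> :: real and n :: nat and A x \<epsilon> y \<gamma>
  assumes \<sigma>: "\<sigma> > 0" and n: "n > 0" and A: "A \<in> carrier_mat n n" and x: "x \<in> carrier_vec n"
    and noise: "gaussian_noise M n \<sigma> \<epsilon>"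
    and y: "\<And>\<omega>. \<omega> \<in> space M \<Longrightarrow> y \<omega> = A *\<^sub>v x + \<epsilon> \<omega>"
    and sv: "singular_values A \<gamma>" and \<gamma>0: "\<gamma> 0 = 1"
    and \<gamma>: "\<And>i j. i \<le> j \<Longrightarrow> j < n \<Longrightarrow> 0 \<le> \<gamma> j \<and> \<gamma> j \<le> \<gamma> i"
begin

abbreviation (input) sup_deviation :: "'a \<Rightarrow> ereal" where
  "sup_deviation \<omega> \<equiv> SUP \<alpha>\<in>{0..}. ereal \<bar>PSURE A \<sigma> \<alpha> (y \<omega>) / real n - pred_loss A x \<alpha> (y \<omega>)\<bar>"

lemma singular_value_bounds: "i < n \<Longrightarrow> 0 \<le> \<gamma> i \<and> \<gamma> i \<le> 1"
  using \<gamma>[of 0 i] \<gamma>0 by auto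

lemma borel_measurable_sup_deviation: "sup_deviation \<in> borel_measurable M"
proof -
  obtain b e where "(\<Sum>i<n. (b i)\<^sup>2) \<le> sq_norm2 x" and indep: "indep_vars (\<lambda>_. borel) e {..<n}"
    and "\<And>i. i < n \<Longrightarrow> distr M borel (e i) = normal_law \<sigma>"
    and eq: "\<And>\<omega> \<alpha>. \<omega> \<in> space M \<Longrightarrow> \<alpha> \<ge> 0 \<Longrightarrow> PSURE A \<sigma> \<alpha> (y \<omega>) / real n - pred_loss A x \<alpha> (y \<omega>) =
      (\<Sum>i<n. 2 * (1 - (\<gamma> i)\<^sup>2 / ((\<gamma> i)\<^sup>2 + \<alpha>)) * b i * e i \<omega> +
        (1 - 2 * ((\<gamma> i)\<^sup>2 / ((\<gamma> i)\<^sup>2 + \<alpha>))) * ((e i \<omega>)\<^sup>2 - \<sigma>\<^sup>2)) / real n"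
    using PSURE_minus_pred_loss_representation[OF \<sigma> n A x noise y sv singular_value_bounds] by blast
  have e [measurable]: "e i \<in> borel_measurable M" if "i < n" for i
    using indep that by (auto simp: indep_vars_def)
  let ?D = "\<lambda>\<alpha> \<omega>. (\<Sum>i<n. 2 * (1 - (\<gamma> i)\<^sup>2 / ((\<gamma> i)\<^sup>2 + \<alpha>)) * b i * e i \<omega> +
        (1 - 2 * ((\<gamma> i)\<^sup>2 / ((\<gamma> i)\<^sup>2 + \<alpha>))) * ((e i \<omega>)\<^sup>2 - \<sigma>\<^sup>2)) / real n"
  \<comment> \<open>A zero singular value gives the filter 0 for all \<alpha>, by
    \<open>0 / 0 = 0\<close> also at the endpoint, so continuity extends down to
    \<open>\<alpha> = 0\<close>.\<close>
  have filter: "continuous_on {0..} (\<lambda>\<alpha>. (\<gamma> i)\<^sup>2 / ((\<gamma> i)\<^sup>2 + \<alpha>))" for i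
  proof (cases "\<gamma> i = 0")
    case False
    then have "(\<gamma> i)\<^sup>2 + \<alpha> \<noteq> 0" if "\<alpha> \<ge> 0" for \<alpha>
      using that by (metis add_pos_nonneg less_irrefl zero_less_power2)
    then show ?thesis by (intro continuous_intros) auto
  qed simp
  have *: "sup_deviation \<omega> = (SUP \<alpha>\<in>{0..} \<inter> \<rat>. ereal \<bar>?D \<alpha> \<omega>\<bar>)" if "\<omega> \<in> space M" for \<omega>
  proof -
    have "sup_deviation \<omega> = (SUP \<alpha>\<in>{0..}. ereal \<bar>?D \<alpha> \<omega>\<bar>)" using eq[OF that] by (intro SUP_cong) auto
    also have "\<dots> = (SUP \<alpha>\<in>{0..} \<inter> \<rat>. ereal \<bar>?D \<alpha> \<omega>\<bar>)"
      using n by (intro SUP_continuous_eq_SUP_rationals continuous_intros filter) auto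
    finally show ?thesis .
  qed
  have "(\<lambda>\<omega>. SUP \<alpha>\<in>{0..} \<inter> \<rat>. ereal \<bar>?D \<alpha> \<omega>\<bar>) \<in> borel_measurable M"
  proof (rule borel_measurable_SUP)
    show "countable ({0..} \<inter> \<rat> :: real set)" using countable_rat by (rule countable_Int2)
    show "(\<lambda>\<omega>. ereal \<bar>?D \<alpha> \<omega>\<bar>) \<in> borel_measurable M" for \<alpha>
      by (intro borel_measurable_ereal borel_measurable_abs borel_measurable_divide borel_measurable_sum
          borel_measurable_add borel_measurable_times borel_measurable_diff borel_measurable_power
          borel_measurable_const e) auto
  qed
  then show ?thesis by (subst measurable_cong[OF *])
qed

text \<open>If the supremum exceeds the threshold, so does the deviation at some \<alpha>, and the
  filter of that \<alpha> is the witness for \<open>monotone_filter_tail\<close>. Multiplying by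
  \<open>n\<close> turns the threshold into \<open>T * sqrt (real n)\<close>.\<close>

lemma sup_deviation_tail:
  assumes T: "T > 0"
  shows "prob {\<omega> \<in> space M. \<bar>sup_deviation \<omega>\<bar> > ereal (T * (1 / sqrt (real n)))}
    \<le> (32 * \<sigma>\<^sup>2 * sq_norm2 x + 40 * real n * \<sigma> ^ 4) / (T\<^sup>2 * real n)" (is "prob ?E \<le> _")
proof -
  obtain b e where b: "(\<Sum>i<n. (b i)\<^sup>2) \<le> sq_norm2 x" and indep: "indep_vars (\<lambda>_. borel) e {..<n}"
    and law: "\<And>i. i < n \<Longrightarrow> distr M borel (e i) = normal_law \<sigma>"
    and eq: "\<And>\<omega> \<alpha>. \<omega> \<in> space M \<Longrightarrow> \<alpha> \<ge> 0 \<Longrightarrow> PSURE A \<sigma> \<alpha> (y \<omega>) / real n - pred_loss A x \<alpha> (y \<omega>) =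
      (\<Sum>i<n. 2 * (1 - (\<gamma> i)\<^sup>2 / ((\<gamma> i)\<^sup>2 + \<alpha>)) * b i * e i \<omega> +
        (1 - 2 * ((\<gamma> i)\<^sup>2 / ((\<gamma> i)\<^sup>2 + \<alpha>))) * ((e i \<omega>)\<^sup>2 - \<sigma>\<^sup>2)) / real n"
    using PSURE_minus_pred_loss_representation[OF \<sigma> n A x noise y sv singular_value_bounds] by blast
  have t: "T * sqrt (real n) > 0" using T n by simp
  have "prob ?E \<le> (32 * \<sigma>\<^sup>2 * (\<Sum>i<n. (b i)\<^sup>2) + 40 * real n * \<sigma> ^ 4) / (T * sqrt (real n))\<^sup>2"
  proof (rule monotone_filter_tail[OF \<sigma> indep law t])
    fix \<omega> assume "\<omega> \<in> ?E"
    then have \<omega>: "\<omega> \<in> space M" and big: "ereal (T * (1 / sqrt (real n))) < \<bar>sup_deviation \<omega>\<bar>" by auto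
    \<comment> \<open>The value at \<open>\<alpha> = 0\<close> is already nonnegative, so the outer
      absolute value disappears.\<close>
    have "sup_deviation \<omega> \<ge> 0"
      by (rule SUP_upper2[of 0]) auto
    with big have "ereal (T * (1 / sqrt (real n))) < sup_deviation \<omega>" by simp
    then obtain \<alpha> where \<alpha>: "\<alpha> \<ge> 0" and
      gt: "T * (1 / sqrt (real n)) < \<bar>PSURE A \<sigma> \<alpha> (y \<omega>) / real n - pred_loss A x \<alpha> (y \<omega>)\<bar>"
      unfolding less_SUP_iff by auto
    let ?f = "\<lambda>i. (\<gamma> i)\<^sup>2 / ((\<gamma> i)\<^sup>2 + \<alpha>)"
    let ?S = "\<Sum>i<n. 2 * (1 - ?f i) * b i * e i \<omega> + (1 - 2 * ?f i) * ((e i \<omega>)\<^sup>2 - \<sigma>\<^sup>2)"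
    have "T * (1 / sqrt (real n)) < \<bar>?S\<bar> / real n" using gt unfolding eq[OF \<omega> \<alpha>] by simp
    then have "T * (1 / sqrt (real n)) * real n < \<bar>?S\<bar>" using n by (simp add: pos_less_divide_eq)
    moreover have "T * (1 / sqrt (real n)) * real n = T * sqrt (real n)"
      using n by (simp add: field_simps)
    ultimately have "T * sqrt (real n) < \<bar>?S\<bar>" by simp
    moreover have "?f j \<le> ?f i" if "i \<le> j" "j < n" for i j
      using \<gamma>[OF that] \<alpha> by (intro divide_add_mono power_mono) auto
    moreover have "0 \<le> ?f i \<and> ?f i \<le> 1" for i
    proof -
      have "0 \<le> (\<gamma> i)\<^sup>2 + \<alpha>" "(\<gamma> i)\<^sup>2 \<le> (\<gamma> i)\<^sup>2 + \<alpha>" using \<alpha> by auto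
      then show ?thesis by (metis divide_le_eq_1_pos divide_nonneg_nonneg div_by_0 order_le_less zero_le_one zero_le_power2)
    qed
    ultimately show "\<omega> \<in> space M \<and> (\<exists>f. (\<forall>i j. i \<le> j \<longrightarrow> j < n \<longrightarrow> f j \<le> f i) \<and> (\<forall>i<n. 0 \<le> f i \<and> f i \<le> 1) \<and>
       T * sqrt (real n) < \<bar>\<Sum>i<n. 2 * (1 - f i) * b i * e i \<omega> + (1 - 2 * f i) * ((e i \<omega>)\<^sup>2 - \<sigma>\<^sup>2)\<bar>)"
      using \<omega> by (intro conjI exI[of _ ?f]) auto
  qed
  also have "\<dots> \<le> (32 * \<sigma>\<^sup>2 * sq_norm2 x + 40 * real n * \<sigma> ^ 4) / (T * sqrt (real n))\<^sup>2"
    using b by (intro divide_right_mono add_right_mono mult_left_mono) auto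
  also have "(T * sqrt (real n))\<^sup>2 = T\<^sup>2 * real n" by (simp add: power_mult_distrib)
  finally show ?thesis .
qed

end
end

section \<open>From the tail bound to the stochastic order\<close>

theorem theorem1:
  fixes M :: "nat \<Rightarrow> 'a measure"
    and A :: "nat \<Rightarrow> real mat"
    and \<gamma> :: "nat \<Rightarrow> nat \<Rightarrow> real"
    and xs :: "nat \<Rightarrow> real vec"
    and \<epsilon> y :: "nat \<Rightarrow> 'a \<Rightarrow> real vec"
    and \<sigma> :: real
  assumes "\<sigma> > 0"
    and "\<And>m. m \<ge> 1 \<Longrightarrow> prob_space (M m)"
    and "\<And>m. m \<ge> 1 \<Longrightarrow> A m \<in> carrier_mat m m"
    and "\<And>m. m \<ge> 1 \<Longrightarrow> xs m \<in> carrier_vec m"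
    and "\<And>m. m \<ge> 1 \<Longrightarrow> gaussian_noise (M m) m \<sigma> (\<epsilon> m)"
    and "\<And>m \<omega>. m \<ge> 1 \<Longrightarrow> \<omega> \<in> space (M m) \<Longrightarrow> y m \<omega> = A m *\<^sub>v xs m + \<epsilon> m \<omega>"
    and "\<And>m. m \<ge> 1 \<Longrightarrow> singular_values (A m) (\<gamma> m)"
    and "\<And>m. m \<ge> 1 \<Longrightarrow> \<gamma> m 0 = 1"
    and "\<And>m i j. i \<le> j \<Longrightarrow> j < m \<Longrightarrow> 0 \<le> \<gamma> m j \<and> \<gamma> m j \<le> \<gamma> m i"
    and "(\<lambda>m. sq_norm2 (xs m)) \<in> O(\<lambda>m. real m)"
  shows "bigo_prob M
           (\<lambda>m \<omega>. SUP \<alpha>\<in>{0..}.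
              ereal \<bar>PSURE (A m) \<sigma> \<alpha> (y m \<omega>) / real m - pred_loss (A m) (xs m) \<alpha> (y m \<omega>)\<bar>)
           (\<lambda>m. 1 / sqrt (real m))"
  unfolding bigo_prob_def
proof (intro conjI allI impI)
  fix m :: nat assume m: "m \<ge> 1"
  then have m': "m > 0" by simp
  show "(\<lambda>\<omega>. SUP \<alpha>\<in>{0..}. ereal \<bar>PSURE (A m) \<sigma> \<alpha> (y m \<omega>) / real m - pred_loss (A m) (xs m) \<alpha> (y m \<omega>)\<bar>)
    \<in> borel_measurable (M m)"
    by (rule prob_space.borel_measurable_sup_deviation[OF assms(2)[OF m] assms(1) m' assms(3)[OF m] assms(4)[OF m]
          assms(5)[OF m] assms(6)[OF m] assms(7)[OF m] assms(8)[OF m] assms(9)])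
next
  let ?P = "\<lambda>T m. measure (M m) {\<omega> \<in> space (M m). ereal (T * (1 / sqrt (real m))) <
    \<bar>SUP \<alpha>\<in>{0..}. ereal \<bar>PSURE (A m) \<sigma> \<alpha> (y m \<omega>) / real m - pred_loss (A m) (xs m) \<alpha> (y m \<omega>)\<bar>\<bar>}"
  obtain C where C: "C > 0" "\<forall>\<^sub>F m in sequentially. sq_norm2 (xs m) \<le> C * real m"
  proof -
    obtain C where "C > 0" "\<forall>\<^sub>F m in sequentially. norm (sq_norm2 (xs m)) \<le> C * norm (real m)"
      using assms(10) by (elim landau_o.bigE)
    then show thesis by (intro that[of C]) (auto elim!: eventually_mono)
  qed
  \<comment> \<open>Once \<open>sq_norm2 (xs m)\<close> is replaced by \<open>C * real m\<close>,
    the dimension cancels from the tail bound and \<open>K / T\<^sup>2\<close> is left.\<close>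
  define K where "K = 32 * \<sigma>\<^sup>2 * C + 40 * \<sigma> ^ 4"
  have bound: "limsup (\<lambda>m. ereal (?P T m)) \<le> ereal (K / T\<^sup>2)" if T: "T > 0" for T
  proof (rule Limsup_bounded)
    show "\<forall>\<^sub>F m in sequentially. ereal (?P T m) \<le> ereal (K / T\<^sup>2)"
      \<comment> \<open>The upper limit discards dimension 0 and the finitely many \<open>m\<close>
        for which the growth bound may fail.\<close>
      using C(2) eventually_ge_at_top[of 1]
    proof eventually_elim
      case (elim m)
      note m = elim(2)
      then have m': "m > 0" by simp
      have "?P T m \<le> (32 * \<sigma>\<^sup>2 * sq_norm2 (xs m) + 40 * real m * \<sigma> ^ 4) / (T\<^sup>2 * real m)"
        by (rule prob_space.sup_deviation_tail[OF assms(2)[OF m] assms(1) m' assms(3)[OF m] assms(4)[OF m]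
          assms(5)[OF m] assms(6)[OF m] assms(7)[OF m] assms(8)[OF m] assms(9) T])
      also have "\<dots> \<le> (32 * \<sigma>\<^sup>2 * (C * real m) + 40 * real m * \<sigma> ^ 4) / (T\<^sup>2 * real m)"
        using elim(1) by (intro divide_right_mono add_right_mono mult_left_mono) auto
      also have "\<dots> = (K * real m) / (T\<^sup>2 * real m)" by (simp add: K_def algebra_simps)
      also have "\<dots> = K / T\<^sup>2" using m' by simp
      finally show ?case by simp
    qed
  qed
  have "((\<lambda>T::real. K / T\<^sup>2) \<longlongrightarrow> 0) at_top"
    by (intro tendsto_divide_0[OF tendsto_const] filterlim_at_top_imp_at_infinity filterlim_pow_at_top filterlim_ident) simp
  then have upper: "((\<lambda>T::real. ereal (K / T\<^sup>2)) \<longlongrightarrow> 0) at_top"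
    by (simp add: zero_ereal_def)
  have lower: "0 \<le> limsup (\<lambda>m. ereal (?P T m))" for T
    by (rule le_Limsup) (auto intro!: always_eventually)
  show "((\<lambda>T::real. limsup (\<lambda>m. ereal (?P T m))) \<longlongrightarrow> 0) at_top"
    by (rule tendsto_sandwich[OF always_eventually[OF allI[OF lower]]
          eventually_mono[OF eventually_gt_at_top[of 0] bound] tendsto_const upper])
qed

end
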